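(* Let $\mathcal{K},c,r,\gamma>0$, let $M\ge 1$ be an integer, let $t_0<T$, and let $m_0$ be a continuously differentiable probability density on $\mathbb{R}$. Consider the mean field mining game described in the context with exponential utility $U(x)=-\frac1\gamma e^{-\gamma x}$, $x\in\mathbb{R}$, and put $$w(r;\gamma)=\frac{1-e^{-\gamma r}}{\gamma}.$$ Then, in the equilibrium, all miners are always active (that is, their hash rate is strictly positive), with constant hash rate $$\alpha^*(t,x)\equiv\bar\alpha^*_t\equiv\frac{\mathcal{K}M}{c(1+M)^2}\,w(r;\gamma),$$ and their individual reward rate is $$\lambda_t\equiv\frac{\mathcal{K}}{1+M},$$ for any $t\in[t_0,T]$ and $x\in\mathbb{R}$. The value function is given by $$v(t,x)=U(x)\,\exp\!\Big(-\gamma\, w(r;\gamma)\,\frac{\mathcal{K}(T-t)}{(1+M)^2}\Big).$$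
   Context: Mining game. A continuum of miners, interpreted as $M+1$ players, is labelled by wealth, with initial wealth density $m_0$ at time $t_0$. Fix a path $\bar\alpha=(\bar\alpha_t)_{t\in[t_0,T]}$ of mean hash rates with $\bar\alpha_t>0$. A representative miner chooses a Markovian hash rate $\alpha_t=\alpha(t,X_t)\ge 0$; its wealth satisfies $$dX_t=-c\,\alpha_t\,dt+r\,dN_t,$$ where $c>0$ is the unit cost, $r>0$ the reward, and $N$ is a counting process with jump intensity (reward rate) $$\lambda_t=\mathcal{K}\frac{\alpha_t}{\alpha_t+M\bar\alpha_t}\ \text{ if }\alpha_t>0,\qquad \lambda_t=0\ \text{ if }\alpha_t=0.$$ Wealth may take any value in $\mathbb{R}$. Value function: $v(t,x;\bar\alpha)=\sup_{\alpha\ge0}\mathbb{E}[U(X_T)\mid X_t=x]$. As a standing assumption, $v$ is a classical solution of the HJB equation $$\partial_t v+\sup_{\alpha\ge 0}\Big(-c\alpha\,\partial_xv+\frac{\mathcal{K}\alpha}{\alpha+M\bar\alpha_t}\Delta v\Big)=0,\qquad v(T,x)=U(x),$$ where $\Delta v(t,x;\bar\alpha)=v(t,x+r;\bar\alpha)-v(t,x;\bar\alpha)$; one has $\partial_xv>0$ and $\Delta v>0$. Optimal hash rate: $\alpha^*(t,x;\bar\alpha)$ is the maximizer in the HJB equation, namely $$\alpha^*(t,x;\bar\alpha)=-M\bar\alpha_t+\sqrt{\frac{\mathcal{K}M\bar\alpha_t\,\Delta v(t,x;\bar\alpha)}{c\,\partial_xv(t,x;\bar\alpha)}}\quad\text{if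 } \bar\alpha_t<\frac{\mathcal{K}\Delta v(t,x;\bar\alpha)}{Mc\,\partial_xv(t,x;\bar\alpha)},$$ and $\alpha^*(t,x;\bar\alpha)=0$ otherwise. Let $m(t,\cdot;\bar\alpha)$ be the probability density at time $t$ of the wealth $X_t$ when the hash rate is $\alpha^*(t,X_t;\bar\alpha)$ and $X_{t_0}$ has density $m_0$. A path $\bar\alpha^*$ with $\bar\alpha^*_t>0$ for all $t$ is an equilibrium mean hash rate if $$\bar\alpha^*_t=\int_{\mathbb{R}}\alpha^*(t,x;\bar\alpha^* )\,m(t,x;\bar\alpha^* )\,dx\qquad\text{for all }t\in[t_0,T].$$ For an equilibrium, write $v(t,x)=v(t,x;\bar\alpha^* )$ and $\alpha^*(t,x)=\alpha^*(t,x;\bar\alpha^* )$; the reward rate $\lambda_t$ is the intensity above evaluated at $\alpha_t=\alpha^*(t,X_t)$, $\bar\alpha=\bar\alpha^*$. *)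

theory Defs
  imports "HOL-Probability.Probability"
begin

text \<open>Throughout, \<open>K c r M\<close> are the total reward intensity, unit hashing cost, block reward and
  number of competitors, and \<open>abar\<close> is a path of mean hash rates.\<close>

definition reward_rate :: "real \<Rightarrow> nat \<Rightarrow> real \<Rightarrow> real \<Rightarrow> real" where
  "reward_rate K M ab a = (if a > 0 then K * a / (a + real M * ab) else 0)"

text \<open>Unit-jump counting path started at time \<open>s\<close>; \<^typ>\<open>nat\<close> carries the discrete topology,
  so right-continuity means local constancy to the right.\<close>

definition counting_path :: "real \<Rightarrow> real \<Rightarrow> (real \<Rightarrow> nat) \<Rightarrow> bool" where
  "counting_path s T n \<longleftrightarrow>
     n s = 0 \<and> mono_on {s..T} n \<and>
     (\<forall>u\<in>{s..<T}. continuous (at_right u) n) \<and>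
     (\<forall>u\<in>{s<..T}. eventually (\<lambda>v. n u \<le> n v + 1) (at_left u))"

definition natural_filtration ::
  "'w measure \<Rightarrow> (real \<Rightarrow> 'w \<Rightarrow> real) \<Rightarrow> real \<Rightarrow> real \<Rightarrow> 'w measure" where
  "natural_filtration P X s u =
     sigma (space P) {X v -` B \<inter> space P | v B. v \<in> {s..u} \<and> B \<in> sets borel}"

text \<open>\<open>N\<close> is a counting process on \<open>[s, T]\<close> with intensity \<open>l\<close> relative to the filtration \<open>F\<close>:
  \<open>N\<close> minus the time integral of \<open>l\<close> is an \<open>F\<close>-martingale.\<close>

definition counting_process_with_intensity ::
  "'w measure \<Rightarrow> (real \<Rightarrow> 'w measure) \<Rightarrow> real \<Rightarrow> real \<Rightarrow> (real \<Rightarrow> 'w \<Rightarrow> nat) \<Rightarrow>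
   (real \<Rightarrow> 'w \<Rightarrow> real) \<Rightarrow> bool" where
  "counting_process_with_intensity P F s T N l \<longleftrightarrow>
     (\<forall>w\<in>space P. counting_path s T (\<lambda>u. N u w)) \<and>
     (\<forall>w\<in>space P. set_integrable lborel {s..T} (\<lambda>u. l u w)) \<and>
     (\<forall>u\<in>{s..T}. N u \<in> measurable (F u) (count_space UNIV)) \<and>
     (\<forall>u\<in>{s..T}. integrable P (\<lambda>w. real (N u w))) \<and>
     (\<forall>u\<in>{s..T}. integrable P (\<lambda>w. LBINT q:{s..u}. l q w)) \<and>
     (\<forall>u\<in>{s..T}. \<forall>u'\<in>{u..T}. AE w in P.
        real_cond_exp P (F u) (\<lambda>w. real (N u' w) - real (N u w)) w =
        real_cond_exp P (F u) (\<lambda>w. LBINT q:{u..u'}. l q w) w)"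

text \<open>\<open>(X, N)\<close> solves \<open>dX = - c a(t, X) dt + r dN\<close> on \<open>[s, T]\<close> for the Markovian hash rate \<open>a\<close>;
  the intensity of \<open>N\<close> depends on \<open>a\<close> through the current wealth.\<close>

definition wealth_process ::
  "real \<Rightarrow> real \<Rightarrow> real \<Rightarrow> nat \<Rightarrow> (real \<Rightarrow> real) \<Rightarrow> (real \<Rightarrow> real \<Rightarrow> real) \<Rightarrow> real \<Rightarrow> real \<Rightarrow>
   'w measure \<Rightarrow> (real \<Rightarrow> 'w \<Rightarrow> real) \<Rightarrow> (real \<Rightarrow> 'w \<Rightarrow> nat) \<Rightarrow> bool" where
  "wealth_process K c r M abar a s T P X N \<longleftrightarrow>
     prob_space P \<and>
     set_borel_measurable borel ({s..T} \<times> UNIV) (\<lambda>(u, x). a u x) \<and>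
     (\<forall>u\<in>{s..T}. \<forall>x. 0 \<le> a u x) \<and>
     (\<forall>u\<in>{s..T}. X u \<in> borel_measurable P) \<and>
     (\<forall>w\<in>space P. set_integrable lborel {s..T} (\<lambda>u. a u (X u w))) \<and>
     (\<forall>w\<in>space P. \<forall>u\<in>{s..T}.
        X u w = X s w - c * (LBINT q:{s..u}. a q (X q w)) + r * real (N u w)) \<and>
     counting_process_with_intensity P (natural_filtration P X s) s T N
       (\<lambda>u w. reward_rate K M (abar u) (a u (X u w)))"

text \<open>One fixed sample space type, so that one can quantify over probability spaces inside a
  formula. The laws of an initial wealth together with a sequence of jump times are all carried
  by probability measures on sequences, so no law of a wealth process is lost.\<close>

type_synonym scenario = "nat \<Rightarrow> real"

text \<open>Supremum of \<open>E[U(X_T) | X_t = x]\<close> over all Markovian hash rates. Hash rates for which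
  \<open>U(X_T)\<close> is not integrable are left out: for utilities bounded above their expected utility is
  minus infinity, whereas the Bochner integral would return 0.\<close>

definition value_function ::
  "real \<Rightarrow> real \<Rightarrow> real \<Rightarrow> nat \<Rightarrow> real \<Rightarrow> (real \<Rightarrow> real) \<Rightarrow> (real \<Rightarrow> real) \<Rightarrow> real \<Rightarrow> real \<Rightarrow> real"
  where
  "value_function K c r M T U abar t x =
     Sup {(\<integral>w. U (X T w) \<partial>P) | (P :: scenario measure) X N a.
            wealth_process K c r M abar a t T P X N \<and>
            (\<forall>w\<in>space P. X t w = x) \<and> integrable P (\<lambda>w. U (X T w))}"

definition HJB_objective ::
  "real \<Rightarrow> real \<Rightarrow> nat \<Rightarrow> real \<Rightarrow> real \<Rightarrow> real \<Rightarrow> real \<Rightarrow> real" where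
  "HJB_objective K c M ab vx dv a = - c * a * vx + K * a / (a + real M * ab) * dv"

text \<open>The boundedness condition says that the supremum is finite; without it the real-valued
  supremum would be unspecified.\<close>

definition classical_HJB_solution ::
  "real \<Rightarrow> real \<Rightarrow> real \<Rightarrow> nat \<Rightarrow> real \<Rightarrow> real \<Rightarrow> (real \<Rightarrow> real) \<Rightarrow> (real \<Rightarrow> real) \<Rightarrow>
   (real \<Rightarrow> real \<Rightarrow> real) \<Rightarrow> bool" where
  "classical_HJB_solution K c r M t0 T U abar v \<longleftrightarrow>
     continuous_on ({t0..T} \<times> UNIV) (\<lambda>(t, x). v t x) \<and>
     (\<forall>x. v T x = U x) \<and>
     (\<exists>vt vx. continuous_on ({t0..<T} \<times> UNIV) (\<lambda>(t, x). vt t x) \<and>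
        continuous_on ({t0..<T} \<times> UNIV) (\<lambda>(t, x). vx t x) \<and>
        (\<forall>t\<in>{t0..<T}. \<forall>x.
           ((\<lambda>s. v s x) has_real_derivative vt t x) (at t within {t0..T}) \<and>
           ((\<lambda>y. v t y) has_real_derivative vx t x) (at x) \<and>
           bdd_above (HJB_objective K c M (abar t) (vx t x) (v t (x + r) - v t x) ` {0..}) \<and>
           vt t x +
             (SUP a\<in>{0..}. HJB_objective K c M (abar t) (vx t x) (v t (x + r) - v t x) a) = 0))"

definition optimal_hash_rate ::
  "real \<Rightarrow> real \<Rightarrow> real \<Rightarrow> nat \<Rightarrow> (real \<Rightarrow> real) \<Rightarrow> (real \<Rightarrow> real \<Rightarrow> real) \<Rightarrow> real \<Rightarrow> real \<Rightarrow> real"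
  where
  "optimal_hash_rate K c r M abar v t x =
     (let dv = v t (x + r) - v t x; vx = deriv (\<lambda>y. v t y) x in
      if abar t < K * dv / (real M * c * vx)
      then - real M * abar t + sqrt (K * real M * abar t * dv / (c * vx))
      else 0)"

text \<open>The closed form is the unique maximizer in the HJB equation.\<close>

lemma optimal_hash_rate_nonneg:
  assumes "0 < K" "0 < c" "1 \<le> M" "0 < abar t"
    and "0 < deriv (\<lambda>y. v t y) x" "0 < v t (x + r) - v t x"
  shows "0 \<le> optimal_hash_rate K c r M abar v t x"
proof -
  define D where "D = v t (x + r) - v t x"
  define p where "p = deriv (\<lambda>y. v t y) x"
  define B where "B = real M * abar t"
  have pos: "0 < D" "0 < p" "0 < B" "0 < real M"
    using assms by (auto simp: D_def p_def B_def)
  have "B \<le> sqrt (K * B * D / (c * p))" if "abar t < K * D / (real M * c * p)"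
  proof (rule real_le_rsqrt)
    have "B * c * p \<le> K * D"
      using that pos assms by (simp add: field_simps B_def)
    hence "B * (B * c * p) \<le> B * (K * D)"
      using pos by (intro mult_left_mono) auto
    thus "B\<^sup>2 \<le> K * B * D / (c * p)"
      using pos assms by (simp add: field_simps power2_eq_square)
  qed
  thus ?thesis
    by (auto simp: optimal_hash_rate_def Let_def D_def p_def B_def mult.assoc)
qed

lemma optimal_hash_rate_maximizes:
  assumes "0 < K" "0 < c" "1 \<le> M" "0 < abar t"
    and "0 < deriv (\<lambda>y. v t y) x" "0 < v t (x + r) - v t x"
    and "0 \<le> a" "a \<noteq> optimal_hash_rate K c r M abar v t x"
  shows "HJB_objective K c M (abar t) (deriv (\<lambda>y. v t y) x) (v t (x + r) - v t x) a
       < HJB_objective K c M (abar t) (deriv (\<lambda>y. v t y) x) (v t (x + r) - v t x)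
           (optimal_hash_rate K c r M abar v t x)"
proof -
  define D where "D = v t (x + r) - v t x"
  define p where "p = deriv (\<lambda>y. v t y) x"
  define B where "B = real M * abar t"
  define b where "b = optimal_hash_rate K c r M abar v t x"
  have pos: "0 < D" "0 < p" "0 < B" "0 < real M"
    using assms by (auto simp: D_def p_def B_def)
  have b0: "0 \<le> b"
    unfolding b_def by (rule optimal_hash_rate_nonneg) (use assms in auto)
  have sa: "0 < a + B" and sb: "0 < b + B"
    using pos b0 assms(7) by auto
  have diff: "HJB_objective K c M (abar t) p D b - HJB_objective K c M (abar t) p D a
      = (b - a) * (K * D * B - c * p * (a + B) * (b + B)) / ((a + B) * (b + B))"
    using sa sb unfolding HJB_objective_def B_def[symmetric]
    by (simp add: divide_simps) (simp add: algebra_simps)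
  have "0 < (b - a) * (K * D * B - c * p * (a + B) * (b + B))"
  proof (cases "abar t < K * D / (real M * c * p)")
    case True
    hence b: "b + B = sqrt (K * B * D / (c * p))"
      by (simp add: b_def optimal_hash_rate_def Let_def D_def p_def B_def mult.assoc)
    have "(b + B)\<^sup>2 = K * B * D / (c * p)"
      unfolding b using pos assms by simp
    hence "K * D * B = c * p * (b + B)\<^sup>2"
      using pos assms by (simp add: field_simps)
    hence "(b - a) * (K * D * B - c * p * (a + B) * (b + B)) = c * p * (b + B) * (b - a)\<^sup>2"
      by (simp add: power2_eq_square algebra_simps)
    thus ?thesis
      using pos assms sb by (auto simp: b_def intro!: mult_pos_pos)
  next
    case False
    hence b: "b = 0"
      by (auto simp: b_def optimal_hash_rate_def Let_def D_def p_def)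
    hence a: "0 < a" using assms(7,8) by (simp add: b_def)
    have "K * D \<le> c * p * B"
      using False pos assms by (simp add: field_simps B_def)
    hence "K * D * B \<le> c * p * B * B"
      using pos by (intro mult_right_mono) auto
    also have "\<dots> < c * p * (a + B) * B"
      using pos assms a by (simp add: algebra_simps)
    finally show ?thesis
      using a b by (intro mult_neg_neg) auto
  qed
  hence "0 < HJB_objective K c M (abar t) p D b - HJB_objective K c M (abar t) p D a"
    unfolding diff using mult_pos_pos[OF sa sb] by (rule divide_pos_pos)
  thus ?thesis by (simp add: b_def D_def p_def)
qed

text \<open>\<open>m t\<close> is the density of the wealth at time \<open>t\<close> when the hash rate is the optimal one for
  \<open>abar\<close> and the initial wealth has density \<open>m0\<close>.\<close>

definition equilibrium_mean_hash_rate ::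
  "real \<Rightarrow> real \<Rightarrow> real \<Rightarrow> nat \<Rightarrow> real \<Rightarrow> real \<Rightarrow> (real \<Rightarrow> real) \<Rightarrow> (real \<Rightarrow> real) \<Rightarrow>
   (real \<Rightarrow> real) \<Rightarrow> bool" where
  "equilibrium_mean_hash_rate K c r M t0 T U m0 abar \<longleftrightarrow>
     (let astar = optimal_hash_rate K c r M abar (value_function K c r M T U abar) in
      (\<forall>t\<in>{t0..T}. 0 < abar t) \<and>
      (\<exists>(P :: scenario measure) X N m.
         wealth_process K c r M abar astar t0 T P X N \<and>
         distributed P lborel (X t0) (\<lambda>x. ennreal (m0 x)) \<and>
         (\<forall>t\<in>{t0..T}.
            (\<forall>x. 0 \<le> m t x) \<and>
            distributed P lborel (X t) (\<lambda>x. ennreal (m t x)) \<and>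
            integrable lborel (\<lambda>x. astar t x * m t x) \<and>
            abar t = (\<integral>x. astar t x * m t x \<partial>lborel))))"

definition exp_utility :: "real \<Rightarrow> real \<Rightarrow> real" where
  "exp_utility \<gamma> x = - (1 / \<gamma>) * exp (- \<gamma> * x)"

definition reward_weight :: "real \<Rightarrow> real \<Rightarrow> real" where
  "reward_weight r \<gamma> = (1 - exp (- \<gamma> * r)) / \<gamma>"

end

theory Submission
  imports Defs
begin

text \<open>Under exponential utility, shifting the initial wealth by \<open>h\<close> multiplies the set of attainable
  expected utilities by \<open>exp (- \<gamma> * h)\<close>, so the value function has the form \<open>U x * g t\<close>. The HJB
  equation then becomes a linear differential inequality for \<open>g\<close> that keeps \<open>g\<close> positive, and \<open>g\<close>
  cancels in the optimal hash rate, which therefore does not depend on wealth. The equilibrium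
  condition reduces to a scalar fixed point equation, and at the fixed point the equation for \<open>g\<close>
  has constant coefficients. No verification theorem is needed: the growth of \<open>g\<close> comes from the HJB
  equation, and its form from the definition of the value function.

  Conversely, at the constant fixed point the wealth has to be realised on a concrete probability
  space. The reward counter is then a Poisson process, built from a Poisson number of independent
  uniform points on the time interval; its intensity is verified by a version of Mecke's formula.\<close>

section \<open>Coordinates of product measures\<close>

text \<open>Counting each value at its first index only turns the cardinality of a random set into a
  count of indices satisfying measurable conditions; \<open>measurable_N\<close> relies on
  this.\<close>

lemma card_image_lessThan_Int:
  fixes f :: "nat \<Rightarrow> 'a"
  shows "card (f ` {..<n} \<inter> B) = card {i. i < n \<and> f i \<in> B \<and> (\<forall>j<i. f i \<noteq> f j)}"
proof (induction n)
  case (Suc n)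
  let ?new = "f n \<in> B \<and> f n \<notin> f ` {..<n}"
  have "f ` {..<Suc n} \<inter> B = (if ?new then insert (f n) (f ` {..<n} \<inter> B) else f ` {..<n} \<inter> B)"
    by (auto simp: lessThan_Suc)
  moreover have "{i. i < Suc n \<and> f i \<in> B \<and> (\<forall>j<i. f i \<noteq> f j)} =
      (if ?new then insert n else id) {i. i < n \<and> f i \<in> B \<and> (\<forall>j<i. f i \<noteq> f j)}"
    by (auto simp: less_Suc_eq image_iff)
  ultimately show ?case using Suc by simp
qed simp

context product_prob_space
begin

lemma PiM_eq_distr_fun_upd:
  assumes "i \<in> I"
  shows "PiM I M = distr (M i \<Otimes>\<^sub>M PiM (I - {i}) M) (PiM I M) (\<lambda>(x, X). X(i := x))"
  using distr_pair_PiM_eq_PiM[of "I - {i}" M i] assms prob_space by (simp add: insert_absorb)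

lemma measurable_fun_upd_pair:
  assumes "i \<in> I"
  shows "(\<lambda>(x, X). X(i := x)) \<in> measurable (M i \<Otimes>\<^sub>M PiM (I - {i}) M) (PiM I M)"
proof -
  have "(\<lambda>p. (case (snd p, fst p) of (f, y) \<Rightarrow> f(i := y))) \<in>
      measurable (M i \<Otimes>\<^sub>M PiM (I - {i}) M) (PiM (insert i (I - {i})) M)"
    by (rule measurable_compose[OF _ measurable_add_dim]) measurable
  thus ?thesis using assms by (simp add: insert_absorb case_prod_beta)
qed

text \<open>Splitting off coordinate \<open>i\<close> makes the event a rectangle, whose measure
  factors. This is the independence of a coordinate from an event that ignores it.\<close>

lemma emeasure_PiM_component_Int:
  assumes i: "i \<in> I" and C: "C \<in> sets (M i)" and Q: "Q \<in> sets (PiM I M)"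
    and indep: "\<And>w x. w \<in> space (PiM I M) \<Longrightarrow> x \<in> space (M i) \<Longrightarrow> w(i := x) \<in> Q \<longleftrightarrow> w \<in> Q"
  shows "emeasure (PiM I M) {w \<in> Q. w i \<in> C} = emeasure (M i) C * emeasure (PiM I M) Q"
proof -
  let ?J = "I - {i}" and ?h = "\<lambda>(x, X). X(i := x)"
  interpret J: prob_space "PiM ?J M" by (intro prob_space_PiM prob_space)
  note h = measurable_fun_upd_pair[OF i]
  obtain x0 where x0: "x0 \<in> space (M i)" using M.not_empty by blast
  \<comment> \<open>The value \<open>x0\<close> is arbitrary: by \<open>indep\<close>, changing
    coordinate \<open>i\<close> does not affect membership in \<open>Q\<close>.\<close>
  define Q' where "Q' = {X \<in> space (PiM ?J M). X(i := x0) \<in> Q}"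
  have upd_space: "X(i := x) \<in> space (PiM I M)"
    if "X \<in> space (PiM ?J M)" "x \<in> space (M i)" for X x
    using measurable_space[OF h, of "(x, X)"] that by (simp add: space_pair_measure)
  have "(\<lambda>X. X(i := x0)) = ?h \<circ> (\<lambda>X. (x0, X))" by auto
  moreover have "(\<lambda>X. (x0, X)) \<in> measurable (PiM ?J M) (M i \<Otimes>\<^sub>M PiM ?J M)"
    using x0 by measurable
  ultimately have "(\<lambda>X. X(i := x0)) \<in> measurable (PiM ?J M) (PiM I M)"
    using h by (metis measurable_comp)
  from measurable_sets[OF this Q] have Q': "Q' \<in> sets (PiM ?J M)"
    by (simp add: Q'_def vimage_def Int_def conj_commute)
  have iff: "X(i := x) \<in> Q \<longleftrightarrow> X \<in> Q'" if "X \<in> space (PiM ?J M)" "x \<in> space (M i)" for X x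
    using indep[OF upd_space[OF that(1) x0] that(2)] that by (auto simp: Q'_def)
  have Qsp: "Q \<subseteq> space (PiM I M)" using Q by (rule sets.sets_into_space)
  have key: "emeasure (PiM I M) {w \<in> Q. w i \<in> C'} = emeasure (M i) C' * emeasure (PiM ?J M) Q'"
    if C': "C' \<in> sets (M i)" for C'
  proof -
    have comp: "(\<lambda>w. w i) \<in> measurable (PiM I M) (M i)" using i by measurable
    have "{w \<in> Q. w i \<in> C'} = Q \<inter> ((\<lambda>w. w i) -` C' \<inter> space (PiM I M))" using Qsp by auto
    hence S: "{w \<in> Q. w i \<in> C'} \<in> sets (PiM I M)"
      using Q measurable_sets[OF comp C'] by auto
    have "?h -` {w \<in> Q. w i \<in> C'} \<inter> space (M i \<Otimes>\<^sub>M PiM ?J M) = C' \<times> Q'"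
      using iff sets.sets_into_space[OF C'] by (auto simp: space_pair_measure Q'_def)
    hence "emeasure (PiM I M) {w \<in> Q. w i \<in> C'} = emeasure (M i \<Otimes>\<^sub>M PiM ?J M) (C' \<times> Q')"
      by (subst PiM_eq_distr_fun_upd[OF i]) (use h S in \<open>simp add: emeasure_distr\<close>)
    thus ?thesis using J.emeasure_pair_measure_Times[OF C' Q'] by simp
  qed
  \<comment> \<open>Taking the whole space as first factor in \<open>key\<close> identifies the mass
    of \<open>Q'\<close> with that of \<open>Q\<close>.\<close>
  have "{w \<in> Q. w i \<in> space (M i)} = Q" using Qsp i by (auto simp: space_PiM)
  hence "emeasure (PiM I M) Q = emeasure (PiM ?J M) Q'"
    using key[of "space (M i)"] by (simp add: M.emeasure_space_1)
  thus ?thesis using key[OF C] by simp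
qed

text \<open>Fubini: with the other coordinates fixed, the section of the diagonal lies in a
  singleton, which is null for the law of coordinate \<open>i\<close>.\<close>

lemma AE_PiM_component_neq:
  assumes i: "i \<in> I" "j \<in> I" "i \<noteq> j"
    and S: "{w \<in> space (PiM I M). w i = w j} \<in> sets (PiM I M)"
    and null: "\<And>x. emeasure (M i) {x} = 0"
  shows "AE w in PiM I M. w i \<noteq> w j"
proof -
  let ?J = "I - {i}" and ?h = "\<lambda>(x, X). X(i := x)"
  let ?S = "{w \<in> space (PiM I M). w i = w j}"
  interpret J: prob_space "PiM ?J M" by (intro prob_space_PiM prob_space)
  interpret pair_sigma_finite "M i" "PiM ?J M" ..
  note h = measurable_fun_upd_pair[OF i(1)]
  let ?E = "?h -` ?S \<inter> space (M i \<Otimes>\<^sub>M PiM ?J M)"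
  have E: "?E \<in> sets (M i \<Otimes>\<^sub>M PiM ?J M)" using measurable_sets[OF h S] .
  have "emeasure (PiM I M) ?S = emeasure (M i \<Otimes>\<^sub>M PiM ?J M) ?E"
    using emeasure_distr[OF h S] unfolding PiM_eq_distr_fun_upd[OF i(1), symmetric] .
  also have "\<dots> = (\<integral>\<^sup>+X. emeasure (M i) ((\<lambda>x. (x, X)) -` ?E) \<partial>PiM ?J M)"
    by (rule emeasure_pair_measure_alt2[OF E])
  also have "\<dots> = 0"
  proof -
    have "emeasure (M i) ((\<lambda>x. (x, X)) -` ?E) \<le> emeasure (M i) {X j}"
      if "X \<in> space (PiM ?J M)" for X
    proof -
      have sub: "(\<lambda>x. (x, X)) -` ?E \<subseteq> {X j}" using i by auto
      have "(\<lambda>x. (x, X)) -` ?E \<in> sets (M i)" by (rule sets_Pair2[OF E])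
      thus ?thesis using subset_singletonD[OF sub] by (elim disjE) simp_all
    qed
    hence "(\<integral>\<^sup>+X. emeasure (M i) ((\<lambda>x. (x, X)) -` ?E) \<partial>PiM ?J M) = (\<integral>\<^sup>+X. 0 \<partial>PiM ?J M)"
      unfolding null le_zero_eq by (rule nn_integral_cong)
    thus ?thesis by simp
  qed
  finally have "?S \<in> null_sets (PiM I M)" using S by auto
  thus ?thesis by (auto intro: AE_I')
qed

end

text \<open>Because the two swapped coordinates have the same law, the family of measures is
  unchanged by the swap, and reindexing returns the same product measure.\<close>

lemma emeasure_PiM_transpose:
  fixes M :: "'i \<Rightarrow> 'a measure"
  assumes "\<And>i. prob_space (M i)" "M i = M j" "Q \<in> sets (PiM UNIV M)"
  shows "emeasure (PiM UNIV M) {w \<in> space (PiM UNIV M). w \<circ> Transposition.transpose i j \<in> Q}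
       = emeasure (PiM UNIV M) Q"
proof -
  let ?f = "Transposition.transpose i j"
  have M: "(\<lambda>k. M (?f k)) = M" using assms(2) by (auto simp: Transposition.transpose_def)
  have "distr (PiM UNIV M) (PiM UNIV (\<lambda>k. M (?f k))) (\<lambda>w. \<lambda>k\<in>UNIV. w (?f k)) = PiM UNIV (\<lambda>k. M (?f k))"
    by (rule distr_PiM_reindex) (use assms in auto)
  hence d: "distr (PiM UNIV M) (PiM UNIV M) (\<lambda>w. w \<circ> ?f) = PiM UNIV M"
    by (simp add: M comp_def restrict_UNIV)
  have [measurable]: "(\<lambda>w. w \<circ> ?f) \<in> measurable (PiM UNIV M) (PiM UNIV M)"
  proof (rule measurable_PiM_single')
    fix k
    have "(\<lambda>w. w (?f k)) \<in> measurable (PiM UNIV M) (M (?f k))" by measurable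
    thus "(\<lambda>w. (w \<circ> ?f) k) \<in> measurable (PiM UNIV M) (M k)" using fun_cong[OF M, of k] by simp
  next
    show "(\<lambda>w k. (w \<circ> ?f) k) \<in> space (PiM UNIV M) \<rightarrow> (\<Pi>\<^sub>E i\<in>UNIV. space (M i))"
      using fun_cong[OF M] by (auto simp: space_PiM PiE_def Pi_def) metis
  qed
  show ?thesis
    by (subst (2) d[symmetric])
      (use assms(3) in \<open>simp add: emeasure_distr vimage_def Int_def conj_commute\<close>)
qed

section \<open>A Poisson process on the space of scenarios\<close>

locale poisson_scenario =
  fixes D :: "real measure" and s T lam :: real
  assumes prob_D: "prob_space D" and sets_D[measurable_cong, simp]: "sets D = sets borel"
    and s_less_T: "s < T" and lam_pos: "0 < lam"
begin

text \<open>Coordinate 0 is the initial wealth, coordinate 1 the total number of points, and coordinate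
  \<open>i + 2\<close> the \<open>i\<close>-th point.\<close>

definition coord :: "nat \<Rightarrow> real measure" where
  "coord i = (if i = 0 then D
     else if i = 1 then distr (measure_pmf (poisson_pmf (lam * (T - s)))) borel real
     else uniform_measure lborel {s..T})"

definition P :: "scenario measure" where "P = PiM UNIV coord"

text \<open>Scenarios are real sequences, so the count is stored as a real; the floor yields a
  natural number also off the support of its law.\<close>

definition num :: "scenario \<Rightarrow> nat" where "num w = nat \<lfloor>w 1\<rfloor>"

definition pts :: "scenario \<Rightarrow> real set" where "pts w = (\<lambda>i. w (i + 2)) ` {..<num w}"

text \<open>Counting the points as a set keeps the jumps of size one on the null event that two points
  coincide; a counting path is required for every scenario, not only almost surely.\<close>

definition N :: "real \<Rightarrow> scenario \<Rightarrow> nat" where "N u w = card (pts w \<inter> {s<..u})"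

section \<open>Laws and measurability of the coordinates\<close>

lemma sets_coord[measurable_cong, simp]: "sets (coord i) = sets borel"
  by (simp add: coord_def)

lemma space_coord[simp]: "space (coord i) = UNIV"
  using sets_eq_imp_space_eq[OF sets_coord[of i]] by simp

lemma prob_space_coord: "prob_space (coord i)"
proof -
  have "prob_space (uniform_measure lborel {s..T})"
    using s_less_T by (intro prob_space_uniform_measure) auto
  thus ?thesis
    unfolding coord_def using prob_D by (auto intro: measure_pmf.prob_space_distr)
qed

sublocale product_prob_space coord UNIV
  using prob_space_coord by (intro product_prob_spaceI)

sublocale prob_space P
  unfolding P_def by (intro prob_space_PiM prob_space_coord)

lemma space_P[simp]: "space P = UNIV"
  by (simp add: P_def space_PiM)

lemma sets_P: "sets P = sets (PiM UNIV (\<lambda>_. borel))"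
  unfolding P_def by (rule sets_PiM_cong) auto

lemma measurable_coord[measurable]: "(\<lambda>w. w i) \<in> borel_measurable P"
  using measurable_component_singleton[of i UNIV "\<lambda>_. borel :: real measure"]
  by (simp add: measurable_cong_sets[OF sets_P refl])

lemma measurable_num[measurable]: "num \<in> measurable P (count_space UNIV)"
  unfolding num_def by measurable

lemma distr_coord: "distr P borel (\<lambda>w. w i) = coord i"
proof -
  have "distr P (coord i) (\<lambda>w. w i) = coord i"
    unfolding P_def by (rule PiM_component) simp
  thus ?thesis by (metis distr_cong sets_coord)
qed

lemma emeasure_num: "emeasure (coord 1) {x. nat \<lfloor>x\<rfloor> = n} = ennreal (pmf (poisson_pmf (lam * (T - s))) n)"
proof -
  have "{x :: real. nat \<lfloor>x\<rfloor> = n} = (\<lambda>x. nat \<lfloor>x\<rfloor>) -` {n} \<inter> space borel" by auto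
  also have "\<dots> \<in> sets borel" by measurable
  finally have "{x :: real. nat \<lfloor>x\<rfloor> = n} \<in> sets borel" .
  moreover have "real -` {x. nat \<lfloor>x\<rfloor> = n} = {n}" by auto
  ultimately show ?thesis
    by (simp add: coord_def emeasure_distr emeasure_pmf_single)
qed

lemma emeasure_point:
  assumes "s \<le> u" "u \<le> u'" "u' \<le> T"
  shows "emeasure (coord (i + 2)) {u<..u'} = ennreal ((u' - u) / (T - s))"
proof -
  have "{s..T} \<inter> {u<..u'} = {u<..u'}" using assms by auto
  thus ?thesis
    using assms s_less_T by (simp add: coord_def divide_ennreal)
qed

lemma AE_distinct_points: "AE w in P. inj_on (\<lambda>i. w (i + 2)) UNIV"
proof -
  have "AE w in P. w (i + 2) \<noteq> w (j + 2)" if "i \<noteq> j" for i j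
    unfolding P_def
  proof (rule AE_PiM_component_neq)
    show "emeasure (coord (i + 2)) {x} = 0" for x
    proof -
      have "emeasure lborel ({s..T} \<inter> {x}) \<le> emeasure lborel {x}"
        by (intro emeasure_mono) auto
      thus ?thesis by (simp add: coord_def)
    qed
    have "{w \<in> space P. w (i + 2) = w (j + 2)} \<in> sets P" by measurable
    thus "{w \<in> space (PiM UNIV coord). w (i + 2) = w (j + 2)} \<in> sets (PiM UNIV coord)"
      by (simp add: P_def)
  qed (use that in auto)
  hence "AE w in P. \<forall>i j. i \<noteq> j \<longrightarrow> w (i + 2) \<noteq> w (j + 2)"
    by (simp add: AE_all_countable)
  thus ?thesis by eventually_elim (auto simp: inj_on_def)
qed

lemma measurable_fun_upd_P: "(\<lambda>w. w(i := x)) \<in> measurable P P"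
proof -
  have "(\<lambda>w. w(i := x)) \<in> measurable P (PiM UNIV (\<lambda>_. borel))"
  proof (rule measurable_PiM_single')
    fix j show "(\<lambda>w. (w(i := x)) j) \<in> borel_measurable P"
      by (cases "j = i") auto
  qed auto
  thus ?thesis by (simp add: measurable_cong_sets[OF refl sets_P])
qed

lemma measurable_N[measurable]: "N u \<in> measurable P (count_space UNIV)"
proof -
  have "N u = (\<lambda>w. card {i. i < num w \<and> w (i + 2) \<in> {s<..u} \<and> (\<forall>j<i. w (i + 2) \<noteq> w (j + 2))})"
    unfolding N_def pts_def card_image_lessThan_Int ..
  also have "\<dots> \<in> measurable P (count_space UNIV)"
  proof (rule measurable_card)
    fix i
    have "{w \<in> space P. w (i + 2) = w (j + 2)} \<in> sets P" for j
      by measurable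
    hence "Measurable.pred P (\<lambda>w. w (i + 2) \<noteq> w (j + 2))" for j
      by (intro pred_intros_logic) (simp add: pred_def)
    hence "Measurable.pred P (\<lambda>w. \<forall>j\<in>{..<i}. w (i + 2) \<noteq> w (j + 2))"
      by (intro pred_intros_finite) auto
    moreover have "Measurable.pred P (\<lambda>w. i < num w)"
      by measurable
    moreover have "Measurable.pred P (\<lambda>w. w (i + 2) \<in> {s<..u})"
      by measurable
    ultimately have "Measurable.pred P (\<lambda>w. i < num w \<and> w (i + 2) \<in> {s<..u} \<and>
        (\<forall>j\<in>{..<i}. w (i + 2) \<noteq> w (j + 2)))"
      by (intro pred_intros_logic)
    thus "{w \<in> space P. i \<in> {i. i < num w \<and> w (i + 2) \<in> {s<..u} \<and> (\<forall>j<i. w (i + 2) \<noteq> w (j + 2))}} \<in> sets P"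
      unfolding pred_def mem_Collect_eq lessThan_iff Ball_def .
  qed
  finally show ?thesis .
qed

section \<open>Paths of the counter\<close>

lemma finite_pts: "finite (pts w)"
  by (simp add: pts_def)

text \<open>There are finitely many points: immediately to the right of \<open>u\<close> none is
  added, and from a time just before \<open>u\<close> up to \<open>u\<close> only \<open>u\<close>
  itself can be.\<close>

lemma counting_path_N: "counting_path s T (\<lambda>u. N u w)"
proof -
  have fin: "finite (pts w \<inter> A)" for A using finite_pts by auto
  have "\<forall>\<^sub>F v in at_right u. N v w = N u w" for u
  proof -
    have "\<forall>\<^sub>F v in at_right u. u < p \<longrightarrow> v < p" for p
      by (cases "u < p") (auto simp: eventually_at_right_field)
    hence "\<forall>\<^sub>F v in at_right u. \<forall>p\<in>pts w. u < p \<longrightarrow> v < p"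
      by (intro eventually_ball_finite finite_pts ballI)
    moreover have "\<forall>\<^sub>F v in at_right u. u < v" by (rule eventually_at_right_less)
    ultimately show ?thesis
    proof eventually_elim
      case (elim v)
      hence "pts w \<inter> {s<..v} = pts w \<inter> {s<..u}" by force
      thus ?case by (simp add: N_def)
    qed
  qed
  hence "continuous (at_right u) (\<lambda>u. N u w)" for u
    unfolding continuous_within by (intro tendsto_eventually)
  moreover have "\<forall>\<^sub>F v in at_left u. N u w \<le> N v w + 1" for u
  proof -
    have "\<forall>\<^sub>F v in at_left u. p < u \<longrightarrow> p < v" for p
      by (cases "p < u") (auto simp: eventually_at_left_field)
    hence "\<forall>\<^sub>F v in at_left u. \<forall>p\<in>pts w. p < u \<longrightarrow> p < v"
      by (intro eventually_ball_finite finite_pts ballI)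
    thus ?thesis
    proof eventually_elim
      case (elim v)
      hence "pts w \<inter> {s<..u} \<subseteq> insert u (pts w \<inter> {s<..v})" by force
      hence "N u w \<le> card (insert u (pts w \<inter> {s<..v}))"
        unfolding N_def using fin by (intro card_mono) auto
      also have "\<dots> \<le> N v w + 1"
        unfolding N_def by (simp add: card_insert_if fin)
      finally show ?case .
    qed
  qed
  moreover have "mono_on {s..T} (\<lambda>u. N u w)"
    unfolding N_def by (intro mono_onI card_mono fin) auto
  ultimately show ?thesis by (auto simp: counting_path_def N_def)
qed

text \<open>Events of the natural filtration at time \<open>u\<close> are saturated, which is all that the martingale
  property needs to know about them.\<close>

definition saturated :: "real \<Rightarrow> scenario set \<Rightarrow> bool" where
  "saturated u A \<longleftrightarrow> (\<forall>w w'. w 0 = w' 0 \<and> pts w \<inter> {s<..u} = pts w' \<inter> {s<..u} \<longrightarrow> (w \<in> A \<longleftrightarrow> w' \<in> A))"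

lemma saturatedD:
  "saturated u A \<Longrightarrow> w 0 = w' 0 \<Longrightarrow> pts w \<inter> {s<..u} = pts w' \<inter> {s<..u} \<Longrightarrow> w \<in> A \<longleftrightarrow> w' \<in> A"
  unfolding saturated_def by blast

section \<open>Increments of the counter and their intensity\<close>

lemma N_diff: "s \<le> u \<Longrightarrow> u \<le> u' \<Longrightarrow> real (N u' w) - real (N u w) = real (card (pts w \<inter> {u<..u'}))"
proof -
  assume "s \<le> u" "u \<le> u'"
  hence "pts w \<inter> {s<..u'} = (pts w \<inter> {s<..u}) \<union> (pts w \<inter> {u<..u'})" by auto
  hence "N u' w = N u w + card (pts w \<inter> {u<..u'})"
    unfolding N_def using finite_pts[of w] by (subst card_Un_disjoint[symmetric]) auto
  thus ?thesis by simp
qed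

text \<open>The \<open>i\<close>-th point lies after time \<open>u\<close>, so a saturated event ignores it. It is independent of
  the rest, and by exchangeability the remaining \<open>k\<close> points may be taken to be the first ones.\<close>

lemma emeasure_count_and_point:
  assumes u: "s \<le> u" "u \<le> u'" "u' \<le> T" and A: "A \<in> sets P" "saturated u A" and i: "i \<le> k"
  shows "emeasure P {w \<in> A. num w = Suc k \<and> w (i + 2) \<in> {u<..u'}}
       = ennreal (lam * (u' - u) / Suc k) * emeasure P {w \<in> A. num w = k}"
proof -
  let ?p = "\<lambda>n. pmf (poisson_pmf (lam * (T - s))) n"
  define C where "C n = {x :: real. nat \<lfloor>x\<rfloor> = n}" for n
  have C[measurable]: "C n \<in> sets borel" for n
  proof -
    have "C n = (\<lambda>x. nat \<lfloor>x\<rfloor>) -` {n} \<inter> space borel" by (auto simp: C_def)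
    also have "\<dots> \<in> sets borel" by measurable
    finally show ?thesis .
  qed
  \<comment> \<open>Overwriting removes the dependence on coordinates 1 and \<open>i + 2\<close>.
    The replacement point \<open>s\<close> lies outside \<open>{s<..u}\<close>, so a saturated event
    does not see it.\<close>
  define B where "B = {w. w(1 := real (Suc k), i + 2 := s) \<in> A}"
  define B' where "B' = {w. w(1 := real k) \<in> A}"
  have B: "B \<in> sets P"
  proof -
    have "B = (\<lambda>w. w(1 := real (Suc k), i + 2 := s)) -` A \<inter> space P" by (simp add: B_def vimage_def)
    also have "\<dots> \<in> sets P"
      by (rule measurable_sets[OF measurable_compose[OF measurable_fun_upd_P measurable_fun_upd_P] A(1)])
    finally show ?thesis .
  qed
  have B': "B' \<in> sets P"
  proof -
    have "B' = (\<lambda>w. w(1 := real k)) -` A \<inter> space P" by (simp add: B'_def vimage_def)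
    also have "\<dots> \<in> sets P" by (rule measurable_sets[OF measurable_fun_upd_P A(1)])
    finally show ?thesis .
  qed
  have indep: "emeasure P {w \<in> Q. w j \<in> R} = emeasure (coord j) R * emeasure P Q"
    if "Q \<in> sets P" "R \<in> sets borel" "\<And>w x. w(j := x) \<in> Q \<longleftrightarrow> w \<in> Q" for j Q R
    using emeasure_PiM_component_Int[of j R Q] that by (simp add: P_def)
  have "{w \<in> A. num w = Suc k \<and> w (i + 2) \<in> {u<..u'}} = {w \<in> {w \<in> B. w 1 \<in> C (Suc k)}. w (i + 2) \<in> {u<..u'}}"
  proof -
    have "w \<in> A \<longleftrightarrow> w(1 := real (Suc k), i + 2 := s) \<in> A" if "num w = Suc k" "w (i + 2) \<in> {u<..u'}" for w
    proof (rule saturatedD[OF A(2)])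
      show "pts w \<inter> {s<..u} = pts (w(1 := real (Suc k), i + 2 := s)) \<inter> {s<..u}"
        using that by (auto simp: pts_def num_def image_iff split: if_splits)
    qed simp
    thus ?thesis by (auto simp: B_def C_def num_def)
  qed
  also have "emeasure P \<dots> = emeasure (coord (i + 2)) {u<..u'} * (emeasure (coord 1) (C (Suc k)) * emeasure P B)"
  proof -
    have "{w \<in> B. w 1 \<in> C (Suc k)} = B \<inter> {w \<in> space P. w 1 \<in> C (Suc k)}" by auto
    also have "\<dots> \<in> sets P" using B by measurable
    finally have S: "{w \<in> B. w 1 \<in> C (Suc k)} \<in> sets P" .
    have "emeasure P {w \<in> {w \<in> B. w 1 \<in> C (Suc k)}. w (i + 2) \<in> {u<..u'}} =
        emeasure (coord (i + 2)) {u<..u'} * emeasure P {w \<in> B. w 1 \<in> C (Suc k)}"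
      by (rule indep[OF S]) (auto simp: B_def)
    also have "emeasure P {w \<in> B. w 1 \<in> C (Suc k)} = emeasure (coord 1) (C (Suc k)) * emeasure P B"
      by (rule indep[OF B]) (auto simp: B_def fun_upd_twist)
    finally show ?thesis .
  qed
  \<comment> \<open>Swapping points \<open>i\<close> and \<open>k\<close> turns the first
    \<open>Suc k\<close> points without the \<open>i\<close>-th into the first \<open>k\<close>
    points.\<close>
  also have "B = {w \<in> space (PiM UNIV coord). w \<circ> Transposition.transpose (i + 2) (k + 2) \<in> B'}"
  proof -
    have "w(1 := real (Suc k), i + 2 := s) \<in> A \<longleftrightarrow>
        (w \<circ> Transposition.transpose (i + 2) (k + 2))(1 := real k) \<in> A" for w
    proof (rule saturatedD[OF A(2)])
      let ?w = "w(1 := real (Suc k), i + 2 := s)"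
      let ?w' = "(w \<circ> Transposition.transpose (i + 2) (k + 2))(1 := real k)"
      have "pts ?w = insert s ((\<lambda>j. w (j + 2)) ` ({..<Suc k} - {i}))"
        using i by (auto simp: pts_def num_def image_iff)
      moreover have "{..<Suc k} - {i} = Transposition.transpose i k ` {..<k}"
        using i by (auto simp: Transposition.transpose_def image_iff split: if_splits)
      moreover have "Transposition.transpose (i + 2) (k + 2) (j + 2) = Transposition.transpose i k j + 2" for j
        by (auto simp: Transposition.transpose_def)
      ultimately show "pts ?w \<inter> {s<..u} = pts ?w' \<inter> {s<..u}"
        by (auto simp: pts_def num_def image_image)
    qed (simp add: Transposition.transpose_def)
    thus ?thesis by (simp add: B_def B'_def space_PiM)
  qed
  also have "emeasure P \<dots> = emeasure P B'"
    unfolding P_def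
    by (rule emeasure_PiM_transpose) (use prob_space_coord B' in \<open>auto simp: P_def coord_def\<close>)
  also have "emeasure (coord (i + 2)) {u<..u'} * (emeasure (coord 1) (C (Suc k)) * emeasure P B')
      = ennreal (lam * (u' - u) / Suc k) * (emeasure (coord 1) (C k) * emeasure P B')"
  proof -
    have mu: "0 < lam * (T - s)" using lam_pos s_less_T by simp
    \<comment> \<open>Successive Poisson weights have ratio \<open>lam * (T - s) / Suc k\<close>;
      the interval length cancels against the uniform density.\<close>
    have "(u' - u) / (T - s) * ?p (Suc k) = lam * (u' - u) / Suc k * ?p k"
    proof -
      have "?p (Suc k) = lam * (T - s) / Suc k * ?p k"
        using mu by simp
      thus ?thesis using s_less_T by (simp del: pmf_poisson)
    qed
    hence "ennreal ((u' - u) / (T - s)) * ennreal (?p (Suc k)) = ennreal (lam * (u' - u) / Suc k) * ennreal (?p k)"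
      using u s_less_T lam_pos by (simp add: ennreal_mult'[symmetric] del: pmf_poisson)
    thus ?thesis
      unfolding emeasure_point[OF u] C_def emeasure_num by (simp add: mult.assoc[symmetric] del: pmf_poisson)
  qed
  \<comment> \<open>Independence is now read backwards: on the event that the count is
    \<open>k\<close>, overwriting coordinate 1 by \<open>k\<close> changes no point.\<close>
  also have "emeasure (coord 1) (C k) * emeasure P B' = emeasure P {w \<in> B'. w 1 \<in> C k}"
    by (rule indep[symmetric, OF B']) (auto simp: B'_def)
  also have "{w \<in> B'. w 1 \<in> C k} = {w \<in> A. num w = k}"
  proof -
    have "w(1 := real k) \<in> A \<longleftrightarrow> w \<in> A" if "num w = k" for w
      by (rule saturatedD[OF A(2)]) (use that in \<open>auto simp: pts_def num_def\<close>)
    thus ?thesis by (auto simp: B'_def C_def num_def)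
  qed
  finally show ?thesis .
qed

text \<open>The increment is split according to the total count \<open>Suc k\<close> and the index
  of the counted point. The \<open>Suc k\<close> indices contribute equally and cancel the
  denominator in \<open>emeasure_count_and_point\<close>; summing over \<open>k\<close> restores
  \<open>A\<close>.\<close>

lemma nn_integral_increment:
  assumes u: "s \<le> u" "u \<le> u'" "u' \<le> T" and A: "A \<in> sets P" "saturated u A"
  shows "(\<integral>\<^sup>+w. ennreal (real (N u' w) - real (N u w)) * indicator A w \<partial>P)
       = ennreal (lam * (u' - u)) * emeasure P A"
proof -
  define E where "E k i = {w \<in> A. num w = Suc k \<and> w (i + 2) \<in> {u<..u'}}" for k i
  have E[measurable]: "E k i \<in> sets P" for k i
  proof -
    have "E k i = A \<inter> {w \<in> space P. num w = Suc k \<and> w (i + 2) \<in> {u<..u'}}" by (auto simp: E_def)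
    also have "\<dots> \<in> sets P" using A(1) by measurable
    finally show ?thesis .
  qed
  have "AE w in P. ennreal (real (N u' w) - real (N u w)) * indicator A w
      = (\<Sum>k. \<Sum>i\<le>k. indicator (E k i) w)"
    using AE_distinct_points
  proof eventually_elim
    case (elim w)
    \<comment> \<open>Only \<open>k = num w - 1\<close> can contribute. If \<open>num w = 0\<close>,
      truncated subtraction selects \<open>k = 0\<close>, whose events demand one point and do not
      contain \<open>w\<close>.\<close>
    have "(\<Sum>k. \<Sum>i\<le>k. indicator (E k i) w :: ennreal) = (\<Sum>k\<in>{num w - 1}. \<Sum>i\<le>k. indicator (E k i) w)"
      by (intro suminf_finite sum.neutral) (auto simp: E_def split: split_indicator)
    also have "\<dots> = (\<Sum>i\<le>num w - 1. indicator (E (num w - 1) i) w)" by simp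
    also have "\<dots> = of_nat (card {i. i \<le> num w - 1 \<and> w \<in> E (num w - 1) i})"
      by (simp add: indicator_def sum.If_cases Int_def)
    also have "{i. i \<le> num w - 1 \<and> w \<in> E (num w - 1) i} =
        (if w \<in> A then {i. i < num w \<and> w (i + 2) \<in> {u<..u'}} else {})"
      by (auto simp: E_def)
    \<comment> \<open>Almost sure distinctness of the points makes counting indices the same as
      counting points.\<close>
    also have "card {i. i < num w \<and> w (i + 2) \<in> {u<..u'}} = card (pts w \<inter> {u<..u'})"
    proof -
      have "pts w \<inter> {u<..u'} = (\<lambda>i. w (i + 2)) ` {i. i < num w \<and> w (i + 2) \<in> {u<..u'}}"
        by (auto simp: pts_def)
      thus ?thesis using elim by (simp only: card_image[OF inj_on_subset[OF elim subset_UNIV]])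
    qed
    hence "of_nat (card (if w \<in> A then {i. i < num w \<and> w (i + 2) \<in> {u<..u'}} else {}))
        = ennreal (real (N u' w) - real (N u w)) * indicator A w"
      using u by (simp add: N_diff ennreal_of_nat_eq_real_of_nat)
    finally show ?case by simp
  qed
  hence "(\<integral>\<^sup>+w. ennreal (real (N u' w) - real (N u w)) * indicator A w \<partial>P)
      = (\<integral>\<^sup>+w. (\<Sum>k. \<Sum>i\<le>k. indicator (E k i) w) \<partial>P)"
    by (rule nn_integral_cong_AE)
  also have "\<dots> = (\<Sum>k. \<Sum>i\<le>k. emeasure P (E k i))"
    by (simp add: nn_integral_suminf nn_integral_sum)
  also have "\<dots> = (\<Sum>k. ennreal (lam * (u' - u)) * emeasure P {w \<in> A. num w = k})"
  proof (intro suminf_cong)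
    fix k
    have "(\<Sum>i\<le>k. emeasure P (E k i)) =
        (\<Sum>i\<le>k. ennreal (lam * (u' - u) / Suc k) * emeasure P {w \<in> A. num w = k})"
      unfolding E_def by (intro sum.cong refl emeasure_count_and_point u A) simp
    also have "\<dots> = (ennreal (real (Suc k)) * ennreal (lam * (u' - u) / Suc k)) * emeasure P {w \<in> A. num w = k}"
      by (simp add: ennreal_of_nat_eq_real_of_nat[symmetric] mult.assoc del: of_nat_Suc)
    also have "ennreal (real (Suc k)) * ennreal (lam * (u' - u) / Suc k) = ennreal (lam * (u' - u))"
      using u lam_pos by (subst ennreal_mult'[symmetric]) (simp_all del: of_nat_Suc)
    finally show "(\<Sum>i\<le>k. emeasure P (E k i)) = ennreal (lam * (u' - u)) * emeasure P {w \<in> A. num w = k}" .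
  qed
  also have "\<dots> = ennreal (lam * (u' - u)) * (\<Sum>k. emeasure P {w \<in> A. num w = k})"
    by (rule ennreal_suminf_cmult)
  also have "(\<Sum>k. emeasure P {w \<in> A. num w = k}) = emeasure P (\<Union>k. {w \<in> A. num w = k})"
  proof (rule suminf_emeasure)
    have "{w \<in> A. num w = k} = A \<inter> {w \<in> space P. num w = k}" for k by auto
    also have "A \<inter> {w \<in> space P. num w = k} \<in> sets P" for k using A(1) by measurable
    finally show "range (\<lambda>k. {w \<in> A. num w = k}) \<subseteq> sets P" by auto
  qed (auto simp: disjoint_family_on_def)
  also have "(\<Union>k. {w \<in> A. num w = k}) = A" by auto
  finally show ?thesis .
qed

lemma N_mono: "u \<le> u' \<Longrightarrow> N u w \<le> N u' w"
  unfolding N_def using finite_pts by (intro card_mono) auto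

lemma integrable_increment:
  assumes "s \<le> u" "u \<le> u'" "u' \<le> T"
  shows "integrable P (\<lambda>w. real (N u' w) - real (N u w))"
proof (rule integrableI_nonneg)
  have "saturated u UNIV" by (simp add: saturated_def)
  from nn_integral_increment[OF assms _ this] sets.top[of P]
  show "(\<integral>\<^sup>+w. ennreal (real (N u' w) - real (N u w)) \<partial>P) < \<infinity>"
    using emeasure_space_1 by (simp add: ennreal_mult_less_top)
qed (use assms N_mono in \<open>auto simp: of_nat_mono\<close>)

lemma integrable_N: "u \<in> {s..T} \<Longrightarrow> integrable P (\<lambda>w. real (N u w))"
  using integrable_increment[of s u] by (simp add: N_def)

text \<open>Equality of these set integrals is the characterisation of conditional expectation, here
  with a deterministic compensator.\<close>

lemma set_integral_increment:
  assumes u: "s \<le> u" "u \<le> u'" "u' \<le> T" and A: "A \<in> sets P" "saturated u A"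
  shows "(\<integral>w\<in>A. (real (N u' w) - real (N u w)) \<partial>P) = (\<integral>w\<in>A. (lam * (u' - u)) \<partial>P)"
proof -
  have nn: "0 \<le> real (N u' w) - real (N u w)" for w using N_mono[OF u(2)] by simp
  have "(\<integral>w\<in>A. (real (N u' w) - real (N u w)) \<partial>P) =
      enn2real (\<integral>\<^sup>+w. ennreal (indicator A w * (real (N u' w) - real (N u w))) \<partial>P)"
    unfolding set_lebesgue_integral_def real_scaleR_def
    using A(1) nn by (intro integral_eq_nn_integral) auto
  also have "(\<integral>\<^sup>+w. ennreal (indicator A w * (real (N u' w) - real (N u w))) \<partial>P)
      = ennreal (lam * (u' - u)) * emeasure P A"
    unfolding nn_integral_increment[OF u A, symmetric]
    by (intro nn_integral_cong) (auto split: split_indicator)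
  also have "enn2real \<dots> = lam * (u' - u) * measure P A"
    using u lam_pos by (simp add: enn2real_mult measure_def)
  also have "\<dots> = (\<integral>w\<in>A. (lam * (u' - u)) \<partial>P)"
    using A(1) by (simp add: set_lebesgue_integral_def)
  finally show ?thesis .
qed

section \<open>Wealth at a constant hash rate\<close>

definition wealth :: "real \<Rightarrow> real \<Rightarrow> real \<Rightarrow> scenario \<Rightarrow> real" where
  "wealth b r u w = w 0 - b * (u - s) + r * real (N u w)"

lemma wealth_start: "wealth b r s w = w 0"
  by (simp add: wealth_def N_def)

lemma measurable_wealth[measurable]: "wealth b r u \<in> borel_measurable P"
  unfolding wealth_def by measurable

text \<open>The sets with both properties are closed under the sigma-algebra operations and include
  the generators, since wealth up to time \<open>u\<close> is determined by the initial wealth and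
  the points up to \<open>u\<close>.\<close>

lemma sets_natural_filtration:
  assumes "A \<in> sets (natural_filtration P (wealth b r) s u)"
  shows "A \<in> sets P" "saturated u A"
proof -
  let ?G = "{wealth b r v -` B \<inter> space P | v B. v \<in> {s..u} \<and> B \<in> sets borel}"
  have "A \<in> sigma_sets UNIV ?G"
    using assms by (simp add: natural_filtration_def)
  hence "A \<in> sets P \<and> saturated u A"
  proof induction
    case (Basic A)
    then obtain v B where v: "v \<in> {s..u}" "B \<in> sets borel" "A = wealth b r v -` B \<inter> space P" by auto
    have "wealth b r v w = wealth b r v w'" if "w 0 = w' 0" and "pts w \<inter> {s<..u} = pts w' \<inter> {s<..u}" for w w'
    proof -
      have "pts w \<inter> {s<..v} = (pts w \<inter> {s<..u}) \<inter> {..v}" for w using v by auto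
      hence "N v w = N v w'" unfolding N_def using that(2) by metis
      thus ?thesis by (simp add: wealth_def that(1))
    qed
    hence "saturated u A"
      unfolding saturated_def v(3) by (metis Int_iff UNIV_I space_P vimage_eq)
    moreover have "A \<in> sets P" unfolding v(3) by (rule measurable_sets[OF measurable_wealth v(2)])
    ultimately show ?case by simp
  next
    case Empty
    show ?case unfolding saturated_def by simp
  next
    case (Compl A)
    moreover have "saturated u (UNIV - A)" using Compl unfolding saturated_def by blast
    ultimately show ?case using sets.compl_sets[of A P] by simp
  next
    case (Union A)
    moreover have "saturated u (\<Union>i. A i)" using Union unfolding saturated_def by blast
    ultimately show ?case by auto
  qed
  thus "A \<in> sets P" "saturated u A" by auto
qed

lemma subalgebra_natural_filtration: "subalgebra P (natural_filtration P (wealth b r) s u)"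
  using sets_natural_filtration(1) unfolding subalgebra_def by (auto simp: natural_filtration_def)

lemma measurable_N_natural_filtration:
  assumes "r \<noteq> 0" "s \<le> u"
  shows "N u \<in> measurable (natural_filtration P (wealth b r) s u) (count_space UNIV)"
proof -
  let ?F = "natural_filtration P (wealth b r) s u"
  have gen: "wealth b r v \<in> borel_measurable ?F" if "v \<in> {s..u}" for v
    unfolding natural_filtration_def
  proof (rule measurableI)
    fix B :: "real set" assume "B \<in> sets borel"
    hence "wealth b r v -` B \<inter> space P \<in> {wealth b r v -` B \<inter> space P | v B. v \<in> {s..u} \<and> B \<in> sets borel}"
      using that by blast
    thus "wealth b r v -` B \<inter> space (sigma (space P) {wealth b r v -` B \<inter> space P | v B. v \<in> {s..u} \<and> B \<in> sets borel})
        \<in> sets (sigma (space P) {wealth b r v -` B \<inter> space P | v B. v \<in> {s..u} \<and> B \<in> sets borel})"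
      by (subst sets_measure_of) auto
  qed auto
  have aux: "(\<lambda>w. nat \<lfloor>(f w - g w + k) / r\<rfloor>) \<in> measurable ?F (count_space UNIV)"
    if [measurable]: "f \<in> borel_measurable ?F" "g \<in> borel_measurable ?F" for f g :: "scenario \<Rightarrow> real" and k
    by measurable
  \<comment> \<open>The counter is recovered from observed wealth by adding back the cost and
    dividing by the reward, hence \<open>r\<close> must be nonzero.\<close>
  have "N u = (\<lambda>w. nat \<lfloor>(wealth b r u w - wealth b r s w + b * (u - s)) / r\<rfloor>)"
    using assms by (auto simp: wealth_def N_def)
  also have "\<dots> \<in> measurable ?F (count_space UNIV)"
    using assms by (intro aux gen) auto
  finally show ?thesis .
qed

lemma set_integrable_interval_const:
  assumes "\<And>q. q \<in> {s..T} \<Longrightarrow> l q = (k :: real)"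
  shows "set_integrable lborel {s..T} l"
    and "s \<le> u \<Longrightarrow> u \<le> u' \<Longrightarrow> u' \<le> T \<Longrightarrow> (LBINT q:{u..u'}. l q) = k * (u' - u)"
proof -
  have "set_integrable lborel {s..T} (\<lambda>_. k)"
    unfolding set_integrable_def by (intro integrable_scaleR_left integrable_real_indicator) (auto simp: emeasure_lborel_Icc_eq)
  thus "set_integrable lborel {s..T} l"
    using assms set_integrable_cong[of lborel lborel "{s..T}" "{s..T}" l "\<lambda>_. k"] by simp
  assume u: "s \<le> u" "u \<le> u'" "u' \<le> T"
  have "(LBINT q:{u..u'}. l q) = (LBINT q:{u..u'}. k)"
    using u assms by (intro set_lebesgue_integral_cong) auto
  thus "(LBINT q:{u..u'}. l q) = k * (u' - u)"
    using u by (simp add: set_lebesgue_integral_def)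
qed

text \<open>As the intensity is constant, both conditional expectations equal
  \<open>lam * (u' - u)\<close>; events of the natural filtration are saturated, so
  \<open>set_integral_increment\<close> applies to them.\<close>

lemma counting_process_N:
  assumes "r \<noteq> 0" and l: "\<And>u w. u \<in> {s..T} \<Longrightarrow> l u w = lam"
  shows "counting_process_with_intensity P (natural_filtration P (wealth b r) s) s T N l"
proof -
  have int: "(LBINT q:{u..u'}. l q w) = lam * (u' - u)" if "s \<le> u" "u \<le> u'" "u' \<le> T" for u u' w
    using that by (intro set_integrable_interval_const l)
  have "AE w in P.
      real_cond_exp P (natural_filtration P (wealth b r) s u) (\<lambda>w. real (N u' w) - real (N u w)) w =
      real_cond_exp P (natural_filtration P (wealth b r) s u) (\<lambda>w. LBINT q:{u..u'}. l q w) w"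
    if u: "u \<in> {s..T}" "u' \<in> {u..T}" for u u'
  proof -
    let ?F = "natural_filtration P (wealth b r) s u"
    interpret finite_measure_subalgebra P ?F
      by (intro finite_measure_subalgebra.intro finite_measure_axioms
          finite_measure_subalgebra_axioms.intro subalgebra_natural_filtration)
    have N: "AE w in P. real_cond_exp P ?F (\<lambda>w. real (N u' w) - real (N u w)) w = lam * (u' - u)"
      using u by (intro real_cond_exp_charact set_integral_increment integrable_increment
          sets_natural_filtration) auto
    have l: "AE w in P. real_cond_exp P ?F (\<lambda>w. lam * (u' - u)) w = lam * (u' - u)"
      by (intro real_cond_exp_F_meas) auto
    have eq: "(\<lambda>w. LBINT q:{u..u'}. l q w) = (\<lambda>w. lam * (u' - u))"
      using u int by auto
    show ?thesis unfolding eq using N l by eventually_elim simp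
  qed
  thus ?thesis
    unfolding counting_process_with_intensity_def
    using counting_path_N set_integrable_interval_const(1)[OF l] measurable_N_natural_filtration[OF assms(1)]
      integrable_N int by simp
qed

text \<open>No independence is needed: whatever the counter does, the wealth is one of countably many
  translates of the initial wealth.\<close>

lemma absolutely_continuous_wealth:
  assumes "absolutely_continuous lborel D"
  shows "absolutely_continuous lborel (distr P borel (wealth b r u))"
  unfolding absolutely_continuous_def
proof
  fix A :: "real set" assume A: "A \<in> null_sets lborel"
  hence A'[measurable]: "A \<in> sets borel" by auto
  have "(\<lambda>w. w 0 - b * (u - s) + r * real n) -` A \<inter> space P \<in> null_sets P" for n
  proof -
    let ?d = "r * real n - b * (u - s)"
    have "distr lborel borel (\<lambda>x. x + ?d) = lborel"
      using lborel_distr_plus[of ?d] by (simp add: add.commute[of _ ?d])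
    hence "(\<lambda>x. x + ?d) -` A \<in> null_sets lborel"
      using A null_sets_distr_iff[of "\<lambda>x. x + ?d" lborel borel A] by auto
    hence "(\<lambda>x. x + ?d) -` A \<in> null_sets (distr P borel (\<lambda>w. w 0))"
      using assms by (auto simp: absolutely_continuous_def distr_coord coord_def)
    hence "(\<lambda>w. w 0) -` ((\<lambda>x. x + ?d) -` A) \<inter> space P \<in> null_sets P"
      by (subst (asm) null_sets_distr_iff) auto
    thus ?thesis by (simp add: vimage_def algebra_simps)
  qed
  hence "(\<Union>n. (\<lambda>w. w 0 - b * (u - s) + r * real n) -` A \<inter> space P) \<in> null_sets P" by auto
  moreover have "wealth b r u -` A \<inter> space P \<subseteq> (\<Union>n. (\<lambda>w. w 0 - b * (u - s) + r * real n) -` A \<inter> space P)"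
    by (auto simp: wealth_def)
  ultimately have "wealth b r u -` A \<inter> space P \<in> null_sets P"
    using measurable_sets[OF measurable_wealth A'] null_sets_subset by blast
  thus "A \<in> null_sets (distr P borel (wealth b r u))"
    by (subst null_sets_distr_iff) auto
qed

text \<open>Radon-Nikodym, in the version with a real-valued derivative, because equilibria are
  stated with real nonnegative densities.\<close>

lemma wealth_has_density:
  assumes "absolutely_continuous lborel D"
  obtains m where "\<And>x. 0 \<le> m x" "distributed P lborel (wealth b r u) (\<lambda>x. ennreal (m x))"
proof -
  let ?L = "distr P borel (wealth b r u)"
  have fin: "finite_measure ?L" by (intro finite_measure_distr) auto
  have sets: "sets ?L = sets lborel" by simp
  obtain m where m: "m \<in> borel_measurable lborel" "AE x in lborel. RN_deriv lborel ?L x = ennreal (m x)"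
    "\<And>x. 0 \<le> m x"
    using sigma_finite_measure.real_RN_deriv[OF sigma_finite_lborel fin absolutely_continuous_wealth[OF assms] sets] by metis
  have "density lborel (\<lambda>x. ennreal (m x)) = density lborel (RN_deriv lborel ?L)"
    using m by (intro density_cong) auto
  also have "\<dots> = ?L"
    by (rule sigma_finite_measure.density_RN_deriv[OF sigma_finite_lborel absolutely_continuous_wealth[OF assms] sets])
  finally have "distr P lborel (wealth b r u) = density lborel (\<lambda>x. ennreal (m x))"
    by (metis distr_cong sets_lborel)
  thus thesis using m by (intro that[of m]) (auto simp: distributed_def)
qed

text \<open>A hash rate that ignores wealth removes the feedback from wealth to intensity, so the
  Poisson counter can be built first. The rate is prescribed on \<open>{s..T}\<close> only, which is
  where the optimal rate will be known.\<close>

lemma wealth_process_constant: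
  assumes "r \<noteq> 0" "0 \<le> a0" and a: "\<And>u x. u \<in> {s..T} \<Longrightarrow> a u x = a0"
    and rate: "\<And>u. u \<in> {s..T} \<Longrightarrow> reward_rate K M (abar u) a0 = lam"
  shows "wealth_process K c r M abar a s T P (wealth (c * a0) r) N"
proof -
  have "(\<lambda>p. indicator ({s..T} \<times> UNIV) p *\<^sub>R (case p of (u, x) \<Rightarrow> a u x))
      = (\<lambda>p. indicator ({s..T} \<times> (UNIV :: real set)) p * a0)"
    using a by (auto simp: indicator_def)
  moreover have "({s..T} \<times> (UNIV :: real set)) \<in> sets borel"
    by (intro borel_closed closed_Times) auto
  ultimately have "set_borel_measurable borel ({s..T} \<times> UNIV) (\<lambda>(u, x). a u x)"
    unfolding set_borel_measurable_def by simp
  moreover have "wealth (c * a0) r u w = wealth (c * a0) r s w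
      - c * (LBINT q:{s..u}. a q (wealth (c * a0) r q w)) + r * real (N u w)"
    if "u \<in> {s..T}" for u w
  proof -
    have "(LBINT q:{s..u}. a q (wealth (c * a0) r q w)) = a0 * (u - s)"
      using that by (intro set_integrable_interval_const(2)[OF a]) auto
    thus ?thesis by (simp add: wealth_start) (simp add: wealth_def)
  qed
  moreover have set_int: "set_integrable lborel {s..T} (\<lambda>u. a u (wealth (c * a0) r u w))" for w
    by (rule set_integrable_interval_const(1)[OF a])
  moreover have "counting_process_with_intensity P (natural_filtration P (wealth (c * a0) r) s) s T N
      (\<lambda>u w. reward_rate K M (abar u) (a u (wealth (c * a0) r u w)))"
    using assms by (intro counting_process_N) auto
  ultimately show ?thesis
    unfolding wealth_process_def
    using assms(2) prob_space_axioms measurable_wealth by (intro conjI ballI allI) (auto simp only: a)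
qed

lemma distributed_wealth_start:
  assumes f: "f \<in> borel_measurable borel" and D: "D = density lborel f"
  shows "distributed P lborel (wealth b r s) f"
proof -
  have "distr P lborel (wealth b r s) = distr P borel (\<lambda>w. w 0)"
    by (intro distr_cong) (simp_all add: wealth_start)
  also have "\<dots> = D"
    using distr_coord[of 0] by (simp add: coord_def)
  finally show ?thesis
    unfolding distributed_def D[symmetric] using f by simp
qed

end

text \<open>The Poisson construction with initial law of density \<open>m0\<close>, packaged in the
  form of the existential in the equilibrium condition.\<close>

lemma exists_constant_rate_wealth_process:
  fixes m0 :: "real \<Rightarrow> real"
  assumes m0: "\<And>x. 0 \<le> m0 x" "integrable lborel m0" "(\<integral>x. m0 x \<partial>lborel) = 1"
    and s: "s < T" and r: "r \<noteq> 0" and lam: "0 < lam" and a0: "0 \<le> a0"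
    and a: "\<And>u x. u \<in> {s..T} \<Longrightarrow> a u x = a0"
    and rate: "\<And>u. u \<in> {s..T} \<Longrightarrow> reward_rate K M (abar u) a0 = lam"
  obtains P :: "scenario measure" and X N m
  where "wealth_process K c r M abar a s T P X N"
    and "distributed P lborel (X s) (\<lambda>x. ennreal (m0 x))"
    and "\<forall>t x. 0 \<le> m t x" and "\<forall>t. distributed P lborel (X t) (\<lambda>x. ennreal (m t x))"
proof -
  let ?D = "density lborel (\<lambda>x. ennreal (m0 x))"
  have m0_meas: "(\<lambda>x. ennreal (m0 x)) \<in> borel_measurable borel" using m0(2) by simp
  have "emeasure ?D (space ?D) = (\<integral>\<^sup>+x. ennreal (m0 x) \<partial>lborel)"
    using m0_meas by (simp add: emeasure_density)
  also have "\<dots> = 1"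
    using m0 by (subst nn_integral_eq_integral) auto
  finally have "prob_space ?D" by (rule prob_spaceI)
  hence S: "poisson_scenario ?D s T lam"
    by (intro poisson_scenario.intro) (use s lam in simp_all)
  have ac: "absolutely_continuous lborel ?D"
    using m0_meas by (intro absolutely_continuousI_density) simp
  let ?P = "poisson_scenario.P ?D s T lam"
  let ?X = "poisson_scenario.wealth s (c * a0) r"
  have "\<exists>m. (\<forall>x. 0 \<le> m x) \<and> distributed ?P lborel (?X t) (\<lambda>x. ennreal (m x))" for t
    using poisson_scenario.wealth_has_density[OF S ac] by metis
  then obtain m where m: "\<forall>t x. 0 \<le> m t x"
    "\<forall>t. distributed ?P lborel (?X t) (\<lambda>x. ennreal (m t x))"
    by metis
  have "wealth_process K c r M abar a s T ?P ?X (poisson_scenario.N s)"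
    by (rule poisson_scenario.wealth_process_constant[OF S r a0 a rate])
  moreover have "distributed ?P lborel (?X s) (\<lambda>x. ennreal (m0 x))"
    by (rule poisson_scenario.distributed_wealth_start[OF S m0_meas refl])
  ultimately show thesis by (rule that[OF _ _ m])
qed

section \<open>Scaling of the value function\<close>

text \<open>Naming the set under the supremum in \<open>value_function\<close> lets shifts of wealth
  act on single payoffs.\<close>

definition payoffs ::
  "real \<Rightarrow> real \<Rightarrow> real \<Rightarrow> nat \<Rightarrow> real \<Rightarrow> (real \<Rightarrow> real) \<Rightarrow> (real \<Rightarrow> real) \<Rightarrow> real \<Rightarrow> real \<Rightarrow> real set"
  where
  "payoffs K c r M T U abar t x =
     {(\<integral>w. U (X T w) \<partial>P) | (P :: scenario measure) X N a.
        wealth_process K c r M abar a t T P X N \<and>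
        (\<forall>w\<in>space P. X t w = x) \<and> integrable P (\<lambda>w. U (X T w))}"

lemma value_function_eq_Sup_payoffs:
  "value_function K c r M T U abar t x = Sup (payoffs K c r M T U abar t x)"
  by (simp add: value_function_def payoffs_def)

lemma natural_filtration_add:
  "natural_filtration P (\<lambda>u w. X u w + h) s = natural_filtration P X s"
proof -
  \<comment> \<open>One inclusion for an arbitrary process and shift; used with \<open>h\<close> and
    with \<open>- h\<close> it gives equality.\<close>
  have shift: "{(\<lambda>w. Y v w + k) -` B \<inter> space P | v B. v \<in> {s..u} \<and> B \<in> sets borel}
      \<subseteq> {Y v -` B \<inter> space P | v B. v \<in> {s..u} \<and> B \<in> sets borel}" for Y :: "real \<Rightarrow> 'a \<Rightarrow> real" and k u
  proof clarify
    fix v and B :: "real set" assume "v \<in> {s..u}" "B \<in> sets borel"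
    moreover have "(\<lambda>y. y + k) -` B \<inter> space borel \<in> sets borel"
      by (rule measurable_sets[OF _ \<open>B \<in> sets borel\<close>]) measurable
    ultimately show "\<exists>v' B'. (\<lambda>w. Y v w + k) -` B \<inter> space P = Y v' -` B' \<inter> space P \<and> v' \<in> {s..u} \<and> B' \<in> sets borel"
      by (intro exI[of _ v] exI[of _ "(\<lambda>y. y + k) -` B"]) auto
  qed
  show ?thesis
    unfolding natural_filtration_def using shift[of X h] shift[of "\<lambda>u w. X u w + h" "- h"]
    by (intro ext arg_cong[where f = "sigma (space P)"] subset_antisym) simp_all
qed

text \<open>Feeding the strategy \<open>x - h\<close> makes the shifted miner use the same hash rate
  in every scenario, so the counter and its intensity are unchanged.\<close>

lemma wealth_process_shift:
  assumes "wealth_process K c r M abar a s T P X N"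
  shows "wealth_process K c r M abar (\<lambda>u x. a u (x - h)) s T P (\<lambda>u w. X u w + h) N"
proof -
  have a: "(\<lambda>p. indicator ({s..T} \<times> UNIV) p *\<^sub>R (case p of (u, x) \<Rightarrow> a u x)) \<in> borel_measurable borel"
    using assms by (simp add: wealth_process_def set_borel_measurable_def)
  have h: "(\<lambda>p. (fst p, snd p - h)) \<in> measurable borel (borel :: (real \<times> real) measure)"
    by (intro borel_measurable_continuous_onI continuous_intros)
  have "(\<lambda>p. indicator ({s..T} \<times> UNIV) (fst p, snd p - h) *\<^sub>R
      (case (fst p, snd p - h) of (u, x) \<Rightarrow> a u x)) \<in> borel_measurable borel"
    by (rule measurable_compose[OF h a])
  moreover have "(\<lambda>p. indicator ({s..T} \<times> UNIV) (fst p, snd p - h) *\<^sub>R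
      (case (fst p, snd p - h) of (u, x) \<Rightarrow> a u x))
      = (\<lambda>p. indicator ({s..T} \<times> UNIV) p *\<^sub>R (case p of (u, x) \<Rightarrow> a u (x - h)))"
    by (auto simp: indicator_def)
  ultimately have meas: "set_borel_measurable borel ({s..T} \<times> UNIV) (\<lambda>(u, x). a u (x - h))"
    by (simp only: set_borel_measurable_def)
  have "\<forall>u\<in>{s..T}. \<forall>x. 0 \<le> a u (x - h)"
    using assms unfolding wealth_process_def by blast
  moreover have "\<forall>u\<in>{s..T}. (\<lambda>w. X u w + h) \<in> borel_measurable P"
    using assms unfolding wealth_process_def by auto
  moreover have "\<forall>w\<in>space P. \<forall>u\<in>{s..T}.
      X u w + h = X s w + h - c * (LBINT q:{s..u}. a q (X q w)) + r * real (N u w)"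
  proof (intro ballI)
    fix u w assume "w \<in> space P" "u \<in> {s..T}"
    hence "X u w = X s w - c * (LBINT q:{s..u}. a q (X q w)) + r * real (N u w)"
      using assms unfolding wealth_process_def by blast
    thus "X u w + h = X s w + h - c * (LBINT q:{s..u}. a q (X q w)) + r * real (N u w)"
      by linarith
  qed
  ultimately show ?thesis
    using assms meas unfolding wealth_process_def natural_filtration_add add_diff_cancel_right'
    by (elim conjE) (intro conjI; assumption)
qed

text \<open>Mining at rate 0 keeps wealth constant, even under a point mass. It shows that the
  supremum defining the value function ranges over a nonempty set.\<close>

lemma wealth_process_idle:
  "wealth_process K c r M abar (\<lambda>_ _. 0) s T (return (count_space UNIV) w0) (\<lambda>_ _. x) (\<lambda>_ _. 0)"
proof -
  have "counting_path s T (\<lambda>_. 0)"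
    by (auto simp: counting_path_def intro: mono_onI)
  moreover have "prob_space (return (count_space UNIV) w0)"
    by (intro prob_space_return) simp
  ultimately show ?thesis
    unfolding wealth_process_def counting_process_with_intensity_def
    by (simp add: set_borel_measurable_def set_integrable_def set_lebesgue_integral_def reward_rate_def)
qed

section \<open>Homogeneity of exponential utility and of its value function\<close>

lemma exp_utility_add: "exp_utility \<gamma> (x + h) = exp (- \<gamma> * h) * exp_utility \<gamma> x"
proof -
  have "- \<gamma> * (x + h) = - \<gamma> * h + - \<gamma> * x" by (simp add: algebra_simps)
  thus ?thesis unfolding exp_utility_def by (simp only: exp_add) simp
qed

lemma exp_utility_neg: "0 < \<gamma> \<Longrightarrow> exp_utility \<gamma> x < 0"
  by (simp add: exp_utility_def)

lemma payoffs_nonempty: "payoffs K c r M T U abar t x \<noteq> {}"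
proof -
  let ?P = "return (count_space UNIV) (\<lambda>_. 0) :: scenario measure"
  interpret prob_space ?P by (intro prob_space_return) auto
  have "(\<integral>w. U ((\<lambda>_ _. x) T w) \<partial>?P) \<in> payoffs K c r M T U abar t x"
    unfolding payoffs_def using wealth_process_idle[of K c r M abar t T "\<lambda>_. 0" x]
    by (intro CollectI exI[of _ ?P] exI[of _ "\<lambda>_ _. x"] exI[of _ "\<lambda>_ _. 0"] exI) auto
  thus ?thesis by blast
qed

lemma payoffs_exp_utility_le:
  assumes "0 < \<gamma>" "p \<in> payoffs K c r M T (exp_utility \<gamma>) abar t x"
  shows "p \<le> 0"
proof -
  obtain P X N a where wp: "wealth_process K c r M abar a t T (P :: scenario measure) X N"
    and p: "p = (\<integral>w. exp_utility \<gamma> (X T w) \<partial>P)"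
    using assms(2) by (auto simp: payoffs_def)
  have "0 \<le> (\<integral>w. - exp_utility \<gamma> (X T w) \<partial>P)"
    using less_imp_le[OF exp_utility_neg[OF assms(1)]] by (intro integral_nonneg_AE) auto
  thus ?thesis by (simp add: p)
qed

lemma payoffs_exp_utility_shift:
  assumes "p \<in> payoffs K c r M T (exp_utility \<gamma>) abar t x"
  shows "exp (- \<gamma> * h) * p \<in> payoffs K c r M T (exp_utility \<gamma>) abar t (x + h)"
proof -
  obtain P X N a where wp: "wealth_process K c r M abar a t T (P :: scenario measure) X N"
    "\<forall>w\<in>space P. X t w = x" "integrable P (\<lambda>w. exp_utility \<gamma> (X T w))"
    and p: "p = (\<integral>w. exp_utility \<gamma> (X T w) \<partial>P)"
    using assms by (auto simp: payoffs_def)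
  have "exp (- \<gamma> * h) * p = (\<integral>w. exp_utility \<gamma> (X T w + h) \<partial>P)"
    by (simp add: p exp_utility_add)
  moreover have "integrable P (\<lambda>w. exp_utility \<gamma> (X T w + h))"
    using wp(3) by (simp add: exp_utility_add)
  ultimately show ?thesis
    unfolding payoffs_def using wp(2) wealth_process_shift[OF wp(1), of h]
    by (intro CollectI exI[of _ P] exI[of _ "\<lambda>u w. X u w + h"] exI[of _ N] exI) auto
qed

lemma value_function_exp_utility_nonpos:
  "0 < \<gamma> \<Longrightarrow> value_function K c r M T (exp_utility \<gamma>) abar t x \<le> 0"
  unfolding value_function_eq_Sup_payoffs
  by (intro cSup_least payoffs_nonempty payoffs_exp_utility_le)

lemma value_function_exp_utility_add:
  assumes "0 < \<gamma>"
  shows "value_function K c r M T (exp_utility \<gamma>) abar t (x + h) =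
    exp (- \<gamma> * h) * value_function K c r M T (exp_utility \<gamma>) abar t x"
proof (rule antisym)
  let ?v = "value_function K c r M T (exp_utility \<gamma>) abar t"
  \<comment> \<open>This inequality for every shift suffices: the opposite one is the case of shift
    \<open>- h\<close> started from \<open>x + h\<close>.\<close>
  have ge: "exp (- \<gamma> * k) * ?v y \<le> ?v (y + k)" for k y
  proof -
    have bdd: "bdd_above (payoffs K c r M T (exp_utility \<gamma>) abar t (y + k))"
      using payoffs_exp_utility_le[OF assms] by (meson bdd_aboveI)
    have "?v y \<le> ?v (y + k) / exp (- \<gamma> * k)"
      unfolding value_function_eq_Sup_payoffs
    proof (intro cSup_least payoffs_nonempty)
      fix p assume "p \<in> payoffs K c r M T (exp_utility \<gamma>) abar t y"
      from cSup_upper[OF payoffs_exp_utility_shift[OF this] bdd]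
      show "p \<le> Sup (payoffs K c r M T (exp_utility \<gamma>) abar t (y + k)) / exp (- \<gamma> * k)"
        by (simp add: pos_le_divide_eq mult.commute)
    qed
    thus ?thesis by (simp add: pos_le_divide_eq mult.commute)
  qed
  show "exp (- \<gamma> * h) * ?v x \<le> ?v (x + h)" by (rule ge)
  have "exp (\<gamma> * h) * ?v (x + h) \<le> ?v x" using ge[of "- h" "x + h"] by simp
  hence "exp (- \<gamma> * h) * (exp (\<gamma> * h) * ?v (x + h)) \<le> exp (- \<gamma> * h) * ?v x"
    by (intro mult_left_mono) auto
  thus "?v (x + h) \<le> exp (- \<gamma> * h) * ?v x"
    by (simp add: mult.assoc[symmetric] exp_add[symmetric])
qed

lemma reward_weight_pos: "0 < r \<Longrightarrow> 0 < \<gamma> \<Longrightarrow> 0 < reward_weight r \<gamma>"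
  by (simp add: reward_weight_def)

section \<open>The HJB equation for exponential utility\<close>

text \<open>Besides the HJB equation, only the scaling and the sign of \<open>v\<close> are assumed.
  That \<open>v\<close> is the value function is added separately in the two equilibrium
  lemmas.\<close>

locale exponential_HJB =
  fixes K c r \<gamma> t0 T :: real and M :: nat and abar :: "real \<Rightarrow> real" and v :: "real \<Rightarrow> real \<Rightarrow> real"
  assumes K: "0 < K" and c: "0 < c" and r: "0 < r" and \<gamma>: "0 < \<gamma>" and M: "1 \<le> M" and t0: "t0 < T"
    and abar_pos: "\<And>t. t \<in> {t0..T} \<Longrightarrow> 0 < abar t"
    and classical: "classical_HJB_solution K c r M t0 T (exp_utility \<gamma>) abar v"
    and v_eq: "\<And>t x. v t x = exp (- \<gamma> * x) * v t 0" and v_nonpos: "\<And>t. v t 0 \<le> 0"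
begin

text \<open>The time factor in \<open>v t x = exp_utility \<gamma> x * g t\<close>, which is also
  the wealth derivative of \<open>v\<close> at 0.\<close>

definition g :: "real \<Rightarrow> real" where "g t = - \<gamma> * v t 0"

abbreviation weight :: real where "weight \<equiv> reward_weight r \<gamma>"

text \<open>The Hamiltonian at wealth 0, where the derivative is \<open>g t\<close> and the jump is
  \<open>weight * g t\<close>.\<close>

definition H :: "real \<Rightarrow> real" where
  "H t = (SUP a\<in>{0..}. HJB_objective K c M (abar t) (g t) (weight * g t) a)"

lemma g_nonneg: "0 \<le> g t"
  using v_nonpos[of t] \<gamma> by (simp add: g_def mult_nonneg_nonpos)

lemma v_eq_g: "v t x = exp_utility \<gamma> x * g t"
  using \<gamma> by (subst v_eq) (simp add: g_def exp_utility_def)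

lemma g_T: "g T = 1"
proof -
  have "v T 0 = exp_utility \<gamma> 0" using classical by (simp add: classical_HJB_solution_def)
  thus ?thesis using \<gamma> by (simp add: g_def exp_utility_def)
qed

lemma has_derivative_v: "((\<lambda>y. v t y) has_real_derivative exp (- \<gamma> * x) * g t) (at x)"
proof -
  have "((\<lambda>y. exp (- \<gamma> * y) * v t 0) has_real_derivative exp (- \<gamma> * x) * g t) (at x)"
    by (auto intro!: derivative_eq_intros simp: g_def)
  moreover have "v t = (\<lambda>y. exp (- \<gamma> * y) * v t 0)" by (rule ext) (rule v_eq)
  ultimately show ?thesis by (rule ssubst[rotated])
qed

lemma deriv_v: "deriv (\<lambda>y. v t y) x = exp (- \<gamma> * x) * g t"
  using has_derivative_v by (rule DERIV_imp_deriv)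

lemma jump_v: "v t (x + r) - v t x = exp (- \<gamma> * x) * (weight * g t)"
  using \<gamma> by (simp add: v_eq_g exp_utility_add) (simp add: exp_utility_def reward_weight_def field_simps)

lemma continuous_on_g: "continuous_on {t0..T} g"
proof -
  have "continuous_on ({t0..T} \<times> UNIV) (\<lambda>(t, x). v t x)"
    using classical by (simp add: classical_HJB_solution_def)
  hence "continuous_on {t0..T} ((\<lambda>(t, x). v t x) \<circ> (\<lambda>t. (t, 0)))"
    by (intro continuous_on_compose continuous_intros) (auto elim: continuous_on_subset)
  thus ?thesis unfolding g_def by (intro continuous_intros) (simp add: comp_def)
qed

text \<open>This is the HJB equation at wealth 0, multiplied by \<open>- \<gamma>\<close>.\<close>

lemma has_derivative_g:
  assumes "t \<in> {t0..<T}"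
  shows "(g has_real_derivative \<gamma> * H t) (at t within {t0..T})"
proof -
  obtain vt vx where
    vt: "((\<lambda>s. v s 0) has_real_derivative vt t 0) (at t within {t0..T})" and
    vx: "((\<lambda>y. v t y) has_real_derivative vx t 0) (at 0)" and
    HJB: "vt t 0 + (SUP a\<in>{0..}. HJB_objective K c M (abar t) (vx t 0) (v t (0 + r) - v t 0) a) = 0"
    using classical assms unfolding classical_HJB_solution_def by fast
  \<comment> \<open>The derivative in the HJB equation is only known to exist; uniqueness identifies
    it with the one from the scaling form.\<close>
  have vx0: "vx t 0 = g t" using DERIV_unique[OF vx has_derivative_v] by simp
  have dv: "v t (0 + r) - v t 0 = weight * g t" using jump_v[of t 0] by simp
  have "vt t 0 = - H t" using HJB unfolding vx0 dv H_def by simp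
  thus ?thesis
    unfolding g_def using DERIV_cmult[OF vt, of "- \<gamma>"] by simp
qed

text \<open>Dropping the cost and bounding the share of hash power by 1 gives a linear bound, as
  needed for a Gronwall argument.\<close>

lemma H_le:
  assumes "t \<in> {t0..<T}"
  shows "H t \<le> K * weight * g t"
  unfolding H_def
proof (rule cSUP_least)
  fix a :: real assume a: "a \<in> {0..}"
  have B: "0 < real M * abar t" using assms abar_pos[of t] M by simp
  have wg: "0 \<le> K * (weight * g t)"
    using g_nonneg reward_weight_pos[OF r \<gamma>] K by simp
  have "K * a / (a + real M * abar t) * (weight * g t) = K * (weight * g t) * (a / (a + real M * abar t))"
    by simp
  also have "\<dots> \<le> K * (weight * g t) * 1"
    using a B wg by (intro mult_left_mono) (simp_all add: divide_le_eq)
  finally have "K * a / (a + real M * abar t) * (weight * g t) \<le> K * (weight * g t)" by simp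
  moreover have "0 \<le> c * a * g t" using a c g_nonneg by simp
  ultimately show "HJB_objective K c M (abar t) (g t) (weight * g t) a \<le> K * weight * g t"
    by (simp add: HJB_objective_def)
qed auto

text \<open>An integrating factor with free exponent, used for the inequality in
  \<open>g_pos\<close> and for the equation in \<open>g_fixed_rate\<close>.\<close>

lemma has_derivative_exp_g:
  assumes "t0 < t" "t < T"
  shows "((\<lambda>t. g t * exp (k * t)) has_real_derivative (\<gamma> * H t + k * g t) * exp (k * t)) (at t)"
proof -
  have "(g has_real_derivative \<gamma> * H t) (at t)"
    using has_derivative_g[of t] assms at_within_Icc_at[of t0 t T] by simp
  thus ?thesis by (auto intro!: derivative_eq_intros simp: algebra_simps)
qed

text \<open>Gronwall backwards from \<open>g T = 1\<close>: with the exponent matching the bound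
  \<open>H_le\<close>, the product with the integrating factor is nonincreasing, so its value at
  \<open>t\<close> is at least its positive value at \<open>T\<close>.\<close>

lemma g_pos:
  assumes "t \<in> {t0..T}"
  shows "0 < g t"
proof -
  let ?k = "- \<gamma> * (K * weight)"
  have "g T * exp (?k * T) \<le> g t * exp (?k * t)"
  proof (rule DERIV_nonpos_imp_decreasing_open[of t T "\<lambda>t. g t * exp (?k * t)"])
    show "continuous_on {t..T} (\<lambda>t. g t * exp (?k * t))"
      using assms by (intro continuous_intros continuous_on_subset[OF continuous_on_g]) auto
    fix q assume q: "t < q" "q < T"
    have "\<gamma> * H q + ?k * g q \<le> 0" using H_le[of q] q assms \<gamma> by (simp add: mult.assoc)
    thus "\<exists>y. ((\<lambda>t. g t * exp (?k * t)) has_real_derivative y) (at q) \<and> y \<le> 0"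
      using has_derivative_exp_g[of q ?k] q assms by (intro exI conjI) (auto intro!: mult_nonpos_nonneg)
  qed (use assms in auto)
  hence "0 < g t * exp (?k * t)" using g_T by (simp add: less_le_trans[OF exp_gt_zero])
  thus ?thesis by (simp add: zero_less_mult_iff)
qed

text \<open>Jump and derivative share the factor \<open>exp (- \<gamma> * x) * g t\<close>, which
  cancels. Positivity of \<open>g\<close> matters, since a quotient with zero denominator would be 0
  by convention.\<close>

lemma optimal_hash_rate_eq:
  assumes "t \<in> {t0..T}"
  shows "optimal_hash_rate K c r M abar v t x =
    (if abar t < K * weight / (real M * c)
     then - real M * abar t + sqrt (K * real M * abar t * weight / c) else 0)"
  using g_pos[OF assms] by (simp add: optimal_hash_rate_def Let_def deriv_v jump_v)

text \<open>The positive root \<open>a\<close> of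
  \<open>(1 + M) * a = sqrt (K * M * a * weight / c)\<close>.\<close>

definition fixed_rate :: real where
  "fixed_rate = K * real M / (c * (1 + real M)\<^sup>2) * weight"

lemma fixed_rate_pos: "0 < fixed_rate"
  unfolding fixed_rate_def using K c M reward_weight_pos[OF r \<gamma>]
  by (intro mult_pos_pos divide_pos_pos zero_less_power) auto

lemma fixed_rate_eq: "K * real M * weight = c * (1 + real M)\<^sup>2 * fixed_rate"
proof -
  have "c * (1 + real M)\<^sup>2 \<noteq> 0" using c by (simp add: add_nonneg_eq_0_iff)
  thus ?thesis unfolding fixed_rate_def by simp
qed

lemma fixed_rate_total: "fixed_rate + real M * fixed_rate = (1 + real M) * fixed_rate"
  by (simp add: distrib_right)

lemma fixed_point_imp_fixed_rate:
  assumes "t \<in> {t0..T}" "optimal_hash_rate K c r M abar v t x = abar t"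
  shows "abar t = fixed_rate"
proof -
  have pos: "0 < abar t" "0 < real M" "0 < 1 + real M" using abar_pos[OF assms(1)] M by auto
  \<comment> \<open>The idle branch would force \<open>abar t = 0\<close>, so the square root branch
    holds.\<close>
  have "(1 + real M) * abar t = sqrt (K * real M * abar t * weight / c)"
    using assms(2) pos unfolding optimal_hash_rate_eq[OF assms(1)] by (auto split: if_splits simp: algebra_simps)
  hence "((1 + real M) * abar t)\<^sup>2 = K * real M * abar t * weight / c"
    using pos K c reward_weight_pos[OF r \<gamma>] by simp
  hence "((1 + real M)\<^sup>2 * c * abar t) * abar t = (K * real M * weight) * abar t"
    using c by (simp add: field_simps power2_eq_square)
  hence "(1 + real M)\<^sup>2 * c * abar t = K * real M * weight" using pos by simp
  hence "c * (1 + real M)\<^sup>2 * abar t = c * (1 + real M)\<^sup>2 * fixed_rate"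
    unfolding fixed_rate_eq[symmetric] by (simp add: mult_ac)
  thus ?thesis using c pos by simp
qed

lemma optimal_hash_rate_fixed_rate:
  assumes "t \<in> {t0..T}" "abar t = fixed_rate"
  shows "optimal_hash_rate K c r M abar v t x = fixed_rate"
proof -
  have pos: "0 < weight" "0 < real M" "0 < 1 + real M" using reward_weight_pos[OF r \<gamma>] M by auto
  \<comment> \<open>The activity condition at the fixed rate amounts to the square of
    \<open>M\<close> being less than that of \<open>1 + M\<close>.\<close>
  have "real M * (real M * c * fixed_rate) < (1 + real M)\<^sup>2 * (c * fixed_rate)"
    using c fixed_rate_pos by (simp add: power2_eq_square algebra_simps add_pos_nonneg)
  also have "\<dots> = real M * (K * weight)" using fixed_rate_eq by (simp add: mult_ac)
  finally have less: "fixed_rate < K * weight / (real M * c)"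
    using pos c by (simp add: pos_less_divide_eq mult_ac)
  have "K * real M * fixed_rate * weight = (K * real M * weight) * fixed_rate" by simp
  also have "\<dots> = c * ((1 + real M) * fixed_rate)\<^sup>2"
    unfolding fixed_rate_eq by (simp add: power2_eq_square)
  finally have "K * real M * fixed_rate * weight / c = ((1 + real M) * fixed_rate)\<^sup>2"
    using c by simp
  hence "sqrt (K * real M * fixed_rate * weight / c) = (1 + real M) * fixed_rate"
    using fixed_rate_pos by simp
  thus ?thesis
    unfolding optimal_hash_rate_eq[OF assms(1)] assms(2) using less by (simp add: algebra_simps)
qed

lemma reward_rate_fixed_rate: "reward_rate K M fixed_rate fixed_rate = K / (1 + real M)"
  unfolding reward_rate_def fixed_rate_total using fixed_rate_pos by simp

text \<open>The fixed rate is its own best response, so the supremum is attained there and can be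
  evaluated explicitly.\<close>

lemma H_fixed_rate:
  assumes t: "t \<in> {t0..<T}" and a: "abar t = fixed_rate"
  shows "H t = K * weight / (1 + real M)\<^sup>2 * g t"
proof -
  let ?obj = "HJB_objective K c M (abar t) (g t) (weight * g t)"
  have gt: "0 < g t" using g_pos[of t] t by simp
  have opt: "optimal_hash_rate K c r M abar v t 0 = fixed_rate"
    using optimal_hash_rate_fixed_rate[of t 0] t a by simp
  have dv: "v t (0 + r) - v t 0 = weight * g t" using jump_v[of t 0] by simp
  have "?obj x \<le> ?obj fixed_rate" if "0 \<le> x" for x
  proof (cases "x = fixed_rate")
    case False
    have "HJB_objective K c M (abar t) (deriv (\<lambda>y. v t y) 0) (v t (0 + r) - v t 0) x
        < HJB_objective K c M (abar t) (deriv (\<lambda>y. v t y) 0) (v t (0 + r) - v t 0)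
            (optimal_hash_rate K c r M abar v t 0)"
      using K c M that False opt a fixed_rate_pos gt reward_weight_pos[OF r \<gamma>]
      by (intro optimal_hash_rate_maximizes) (simp_all only: deriv_v dv, simp_all)
    thus ?thesis unfolding deriv_v dv opt by simp
  qed simp
  hence "H t = ?obj fixed_rate"
    unfolding H_def using fixed_rate_pos by (intro cSup_eq_maximum) auto
  also have "\<dots> = g t * (K * weight / (1 + real M) - c * fixed_rate)"
  proof -
    have "K * fixed_rate / ((1 + real M) * fixed_rate) = K / (1 + real M)" using fixed_rate_pos by simp
    thus ?thesis unfolding HJB_objective_def a fixed_rate_total by (simp only:) (simp add: algebra_simps)
  qed
  also have "c * fixed_rate = K * real M * weight / (1 + real M)\<^sup>2"
    unfolding fixed_rate_eq by (simp add: add_nonneg_eq_0_iff)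
  also have "K * weight / (1 + real M) - K * real M * weight / (1 + real M)\<^sup>2
      = K * weight / (1 + real M)\<^sup>2"
  proof -
    \<comment> \<open>Applied with \<open>z - m = 1\<close>.\<close>
    have "y / z - y * m / z\<^sup>2 = y * (z - m) / z\<^sup>2" if "z \<noteq> 0" for y z m :: real
      using that by (simp add: field_simps power2_eq_square)
    from this[of "1 + real M" "K * weight" "real M"] show ?thesis
      by (simp add: mult_ac add_nonneg_eq_0_iff)
  qed
  also have "g t * (K * weight / (1 + real M)\<^sup>2) = K * weight / (1 + real M)\<^sup>2 * g t" by simp
  finally show ?thesis .
qed

text \<open>At the fixed rate the equation for \<open>g\<close> is linear with constant coefficient;
  the integrating factor makes the product constant, and \<open>g T = 1\<close> fixes it.\<close>

lemma g_fixed_rate: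
  assumes a: "\<And>t. t \<in> {t0..T} \<Longrightarrow> abar t = fixed_rate" and t: "t \<in> {t0..T}"
  shows "g t = exp (- \<gamma> * weight * (K * (T - t) / (1 + real M)\<^sup>2))"
proof -
  define k where "k = - \<gamma> * (K * weight / (1 + real M)\<^sup>2)"
  have "g T * exp (k * T) = g t * exp (k * t)"
  proof (cases "t = T")
    case False
    show ?thesis
    proof (rule DERIV_isconst_end[of t T "\<lambda>t. g t * exp (k * t)"])
      show "continuous_on {t..T} (\<lambda>t. g t * exp (k * t))"
        using t by (intro continuous_intros continuous_on_subset[OF continuous_on_g]) auto
      fix q assume q: "t < q" "q < T"
      have "\<gamma> * H q + k * g q = 0" using H_fixed_rate[of q] a[of q] q t by (simp add: k_def)
      thus "((\<lambda>t. g t * exp (k * t)) has_real_derivative 0) (at q)"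
        using has_derivative_exp_g[of q k] q t by simp
    qed (use t False in auto)
  qed simp
  hence "g t = exp (k * T) / exp (k * t)" using g_T by (simp add: field_simps)
  also have "\<dots> = exp (k * (T - t))" by (simp add: exp_diff right_diff_distrib)
  also have "k * (T - t) = - \<gamma> * weight * (K * (T - t) / (1 + real M)\<^sup>2)" by (simp add: k_def)
  finally show ?thesis .
qed

section \<open>Equilibria and the constant mean hash rate\<close>

lemma optimal_hash_rate_wealth_independent:
  "t \<in> {t0..T} \<Longrightarrow> optimal_hash_rate K c r M abar v t x = optimal_hash_rate K c r M abar v t 0"
  by (simp only: optimal_hash_rate_eq)

text \<open>The mean of a wealth-independent rate is that rate, whatever the density, so equilibrium
  becomes a scalar fixed point equation at each time.\<close>

lemma equilibrium_imp_fixed_rate: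
  assumes v: "v = value_function K c r M T (exp_utility \<gamma>) abar"
    and eq: "equilibrium_mean_hash_rate K c r M t0 T (exp_utility \<gamma>) m0 abar" and t: "t \<in> {t0..T}"
  shows "abar t = fixed_rate"
proof -
  let ?a = "optimal_hash_rate K c r M abar v"
  obtain P X N m where wp: "wealth_process K c r M abar ?a t0 T (P :: scenario measure) X N"
    and m: "\<And>x. 0 \<le> m t x" "distributed P lborel (X t) (\<lambda>x. ennreal (m t x))"
      "abar t = (\<integral>x. ?a t x * m t x \<partial>lborel)"
    using eq t unfolding equilibrium_mean_hash_rate_def Let_def v[symmetric] by blast
  have P: "prob_space P" using wp by (simp add: wealth_process_def)
  have "(\<integral>x. m t x * 1 \<partial>lborel) = (\<integral>w. 1 \<partial>P)"
    by (rule distributed_integral[OF m(2)]) (use m(1) in auto)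
  hence "(\<integral>x. m t x \<partial>lborel) = 1"
    using prob_space.prob_space[OF P] by simp
  moreover have "(\<lambda>x. ?a t x * m t x) = (\<lambda>x. ?a t 0 * m t x)"
    using optimal_hash_rate_wealth_independent[OF t] by metis
  ultimately have "abar t = ?a t 0" using m(3) by simp
  thus ?thesis using fixed_point_imp_fixed_rate[OF t, of 0] by simp
qed

text \<open>At the fixed rate every miner's best response is this same constant, so the Poisson
  construction realises the wealth and any density averages the rate to itself.\<close>

lemma fixed_rate_imp_equilibrium:
  assumes v: "v = value_function K c r M T (exp_utility \<gamma>) abar"
    and m0: "\<And>x. 0 \<le> m0 x" "integrable lborel m0" "(\<integral>x. m0 x \<partial>lborel) = 1"
    and a: "\<And>t. t \<in> {t0..T} \<Longrightarrow> abar t = fixed_rate"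
  shows "equilibrium_mean_hash_rate K c r M t0 T (exp_utility \<gamma>) m0 abar"
proof -
  let ?a = "optimal_hash_rate K c r M abar v"
  have opt: "?a t x = fixed_rate" if "t \<in> {t0..T}" for t x
    using optimal_hash_rate_fixed_rate[OF that] a[OF that] by simp
  have rate: "reward_rate K M (abar t) fixed_rate = K / (1 + real M)" if "t \<in> {t0..T}" for t
    using reward_rate_fixed_rate a[OF that] by simp
  have "r \<noteq> 0" "0 < K / (1 + real M)" "0 \<le> fixed_rate" using r K fixed_rate_pos by auto
  then obtain P X N m where wp: "wealth_process K c r M abar ?a t0 T (P :: scenario measure) X N"
    and start: "distributed P lborel (X t0) (\<lambda>x. ennreal (m0 x))"
    and m: "\<forall>t x. 0 \<le> m t x" "\<forall>t. distributed P lborel (X t) (\<lambda>x. ennreal (m t x))"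
    by (rule exists_constant_rate_wealth_process[where a = "?a" and c = c, OF m0 t0 _ _ _ opt rate])
  have P: "prob_space P" using wp by (simp add: wealth_process_def)
  have "integrable lborel (\<lambda>x. ?a t x * m t x) \<and> abar t = (\<integral>x. ?a t x * m t x \<partial>lborel)"
    if t: "t \<in> {t0..T}" for t
  proof -
    have "(\<integral>x. m t x * 1 \<partial>lborel) = (\<integral>w. 1 \<partial>P)"
      by (rule distributed_integral[OF spec[OF m(2)]]) (use m(1) in auto)
    hence mass: "(\<integral>x. m t x \<partial>lborel) = 1"
      using prob_space.prob_space[OF P] by simp
    \<comment> \<open>A function that is not integrable would have Bochner integral 0, not
      1.\<close>
    hence "integrable lborel (m t)" using not_integrable_integral_eq by fastforce
    thus ?thesis using opt[OF t] mass a[OF t] by simp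
  qed
  thus ?thesis
    unfolding equilibrium_mean_hash_rate_def Let_def v[symmetric]
    using wp start m abar_pos by blast
qed

end

theorem proposition3p1:
  fixes K c r \<gamma> t0 T :: real and M :: nat and m0 abar :: "real \<Rightarrow> real"
  defines "U \<equiv> exp_utility \<gamma>"
    and "v \<equiv> value_function K c r M T (exp_utility \<gamma>) abar"
    and "astar \<equiv> optimal_hash_rate K c r M abar
                    (value_function K c r M T (exp_utility \<gamma>) abar)"
    and "ahat \<equiv> K * real M / (c * (1 + real M)\<^sup>2) * reward_weight r \<gamma>"
  assumes "0 < K" "0 < c" "0 < r" "0 < \<gamma>" "1 \<le> M" "t0 < T"
    and m0_density: "\<And>x. 0 \<le> m0 x" "integrable lborel m0" "(\<integral>x. m0 x \<partial>lborel) = 1"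
    and m0_C1: "m0 C1_differentiable_on UNIV"
    and abar_pos: "\<And>t. t \<in> {t0..T} \<Longrightarrow> 0 < abar t"
    and classical: "classical_HJB_solution K c r M t0 T U abar v"
  shows "(equilibrium_mean_hash_rate K c r M t0 T U m0 abar \<longleftrightarrow> (\<forall>t\<in>{t0..T}. abar t = ahat)) \<and>
         (equilibrium_mean_hash_rate K c r M t0 T U m0 abar \<longrightarrow>
           (\<forall>t\<in>{t0..T}. \<forall>x.
              0 < astar t x \<and> astar t x = abar t \<and> abar t = ahat \<and>
              reward_rate K M (abar t) (astar t x) = K / (1 + real M) \<and>
              v t x = U x * exp (- \<gamma> * reward_weight r \<gamma> * (K * (T - t) / (1 + real M)\<^sup>2))))"
proof -
  \<comment> \<open>The scaling identity is the shift rule for the value function started from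
    wealth 0.\<close>
  interpret exponential_HJB K c r \<gamma> t0 T M abar v
  proof
    show "v t x = exp (- \<gamma> * x) * v t 0" for t x
      using value_function_exp_utility_add[OF \<open>0 < \<gamma>\<close>, of K c r M T abar t 0 x] by (simp add: v_def)
    show "v t 0 \<le> 0" for t
      unfolding v_def by (rule value_function_exp_utility_nonpos) fact
  qed (use assms in auto)
  have v: "v = value_function K c r M T (exp_utility \<gamma>) abar" by (simp add: v_def)
  have ahat: "ahat = fixed_rate" unfolding ahat_def fixed_rate_def ..
  have iff: "equilibrium_mean_hash_rate K c r M t0 T U m0 abar \<longleftrightarrow> (\<forall>t\<in>{t0..T}. abar t = ahat)"
    unfolding U_def ahat
    using equilibrium_imp_fixed_rate[OF v] fixed_rate_imp_equilibrium[OF v m0_density] by blast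
  \<comment> \<open>The formulas are derived from constancy of the mean rate; \<open>iff\<close>
    transfers them to equilibria.\<close>
  have "0 < astar t x \<and> astar t x = abar t \<and> abar t = ahat \<and>
      reward_rate K M (abar t) (astar t x) = K / (1 + real M) \<and>
      v t x = U x * exp (- \<gamma> * reward_weight r \<gamma> * (K * (T - t) / (1 + real M)\<^sup>2))"
    if a: "\<forall>t\<in>{t0..T}. abar t = ahat" and t: "t \<in> {t0..T}" for t x
  proof -
    have abar: "abar t = fixed_rate" if "t \<in> {t0..T}" for t
      using a that by (simp add: ahat)
    have "astar t x = fixed_rate"
      using optimal_hash_rate_fixed_rate[OF t abar[OF t]] by (simp add: astar_def v_def)
    moreover have "v t x = U x * exp (- \<gamma> * reward_weight r \<gamma> * (K * (T - t) / (1 + real M)\<^sup>2))"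
      using v_eq_g[of t x] g_fixed_rate[OF abar t] by (simp only: U_def)
    ultimately show ?thesis using fixed_rate_pos abar[OF t] reward_rate_fixed_rate by (simp only: ahat)
  qed
  thus ?thesis using iff by blast
qed

end
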